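(* Let $\lambda\ge 0$, $\eta$ and $\alpha_1,\dots,\alpha_\lambda$ be integers with $0<\alpha_1<\cdots<\alpha_\lambda<\eta$ and $\alpha_i=\eta-\alpha_{\lambda+1-i}$ for $1\le i\le\lambda$. For integers $k,r$ with $k>r\ge\lambda\ge0$ and $k-1>\lambda$, \[ \sum_{n\ge0}\overline{B}_0(\alpha_1,\ldots,\alpha_\lambda;\eta,k,r;n)q^n=(-q^\eta;q^\eta)_\infty\sum_{n\ge0}B_1(\alpha_1,\ldots,\alpha_\lambda;\eta,k-1,r;n)q^n , \] and for integers $k$ with $k-1>\lambda\ge0$, \[ \sum_{n\ge0}\overline{B}_0(\alpha_1,\ldots,\alpha_\lambda;\eta,k,k;n)q^n=(-q^\eta;q^\eta)_\infty\sum_{n\ge0}B_1(\alpha_1,\ldots,\alpha_\lambda;\eta,k-1,k-1;n)q^n . \]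
   Context: Notation: $(a;q)_\infty=\prod_{i\ge0}(1-aq^i)$. Overpartitions: an overpartition of $n$ is a partition of $n$ in which the first occurrence of a part size may be overlined (so overlined parts have distinct sizes). Parts are totally ordered by $1<\bar1<2<\bar2<3<\cdots$; an overpartition is written $\pi=(\pi_1,\dots,\pi_s)$ with $\pi_1\ge\cdots\ge\pi_s$ in this order, and all inequalities between parts (and expressions $x\pm\eta$) are taken in this order, where for a part $x$, $x\pm\eta$ denotes the part of size $|x|\pm\eta$ which is overlined iff $x$ is. $[x/\eta]$ denotes $\lfloor |x|/\eta\rfloor$. $\overline{V}_\pi(N)$ is the number of overlined parts of $\pi$ that are $\le N$ (in this order). $\overline{B}_j(\alpha_1,\ldots,\alpha_\lambda;\eta,k,r;n)$ (for $j\in\{0,1\}$, $k\ge r\ge\lambda\ge0$, $k-1+j>\lambda$) is the number of overpartitions $\pi=(\pi_1,\dots,\pi_s)$ of $n$ such that: (1) every part has size $\equiv 0,\alpha_1,\ldots,\alpha_\lambda\pmod\eta$; (2) only parts whose size is a multiple of $\eta$ may be non-overlined; (3) $\pi_i\ge\pi_{i+k-1}+\eta$ whenever $i+k-1\le s$, with strict inequality if $\pi_i$ is non-overlined; (4) at most $r-1$ of the parts satisfy $\pi_i\le\eta$; (5) whenever $i+k-2\le s$ and $\pi_i\le\pi_{i+k-2}+\eta$ with strict inequality if $\pi_i$ is overlined, then $[\pi_i/\eta]+\cdots+[\pi_{i+k-2}/\eta]\equiv r-1+\overline{V}_\pi(\pi_i)\pmod{2-j}$. $B_j(\alpha_1,\ldots,\alpha_\lambda;\eta,k,r;n)$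 (Bressoud) is the number of ordinary partitions $(\pi_1,\dots,\pi_s)$ of $n$ with $\pi_1\ge\cdots\ge\pi_s$ such that: (1) $\pi_i\equiv0,\alpha_1,\ldots,\alpha_\lambda\pmod\eta$; (2) only multiples of $\eta$ may be repeated; (3) $\pi_i\ge\pi_{i+k-1}+\eta$, with strict inequality if $\eta\mid\pi_i$; (4) at most $r-1$ of the $\pi_i$ are $\le\eta$; (5) if $\pi_i\le\pi_{i+k-2}+\eta$, with strict inequality if $\eta\nmid\pi_i$, then $\lfloor\pi_i/\eta\rfloor+\cdots+\lfloor\pi_{i+k-2}/\eta\rfloor\equiv r-1+V_\pi(\pi_i)\pmod{2-j}$, where $V_\pi(N)$ is the number of parts not exceeding $N$ that are not divisible by $\eta$. (For $j=1$ condition (5) is vacuous.) *)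

theory Defs
  imports
    "HOL-Number_Theory.Cong"
    "HOL-Computational_Algebra.Formal_Power_Series"
    "HOL-Analysis.Infinite_Products"
begin

section \<open>Overpartitions\<close>

datatype part = Part (psize: nat) (overlined: bool)

text \<open>Parts are ordered as $1 < \bar 1 < 2 < \bar 2 < \dots$\<close>

instantiation part :: linorder
begin

definition less_eq_part :: "part \<Rightarrow> part \<Rightarrow> bool" where
  "x \<le> y \<longleftrightarrow> psize x < psize y \<or> psize x = psize y \<and> (overlined x \<longrightarrow> overlined y)"

definition less_part :: "part \<Rightarrow> part \<Rightarrow> bool" where
  "x < y \<longleftrightarrow> psize x < psize y \<or> psize x = psize y \<and> \<not> overlined x \<and> overlined y"

instance
  by standard (auto simp: less_eq_part_def less_part_def intro: part.expand)

end

definition shift_part :: "part \<Rightarrow> nat \<Rightarrow> part" where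
  "shift_part x d = Part (psize x + d) (overlined x)"

text \<open>Since an overlined part is larger than the non-overlined part of the same size, in a weakly
  decreasing list the overlined copy of a part size is automatically its first occurrence.\<close>

definition overpartition :: "nat \<Rightarrow> part list \<Rightarrow> bool" where
  "overpartition n xs \<longleftrightarrow>
     sorted_wrt (\<ge>) xs \<and> (\<forall>x\<in>set xs. 0 < psize x) \<and> distinct (filter overlined xs) \<and>
     (\<Sum>x\<leftarrow>xs. psize x) = n"

definition Vbar :: "part list \<Rightarrow> part \<Rightarrow> nat" where
  "Vbar xs N = length (filter (\<lambda>x. overlined x \<and> x \<le> N) xs)"

text \<open>Lists are indexed from 0, so with \<open>s\<close> the length of the list the one-based condition $i + k - 1 \le s$ becomes
  \<open>i + k \<le> s\<close>, and $i + k - 2 \le s$ becomes \<open>i + k \<le> s + 1\<close>.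
  The bound \<open>r - 1\<close> is an integer: it is \<open>-1\<close> for \<open>r = 0\<close>.
  The residues \<open>\<alpha> 1, \<dots>, \<alpha> l\<close> are the values of a function on \<open>{1..l}\<close>.\<close>

definition Bbar_set ::
  "nat \<Rightarrow> nat \<Rightarrow> (nat \<Rightarrow> nat) \<Rightarrow> nat \<Rightarrow> nat \<Rightarrow> nat \<Rightarrow> nat \<Rightarrow> part list set" where
  "Bbar_set j l \<alpha> \<eta> k r n = {xs. overpartition n xs \<and>
     (\<forall>x\<in>set xs. [psize x = 0] (mod \<eta>) \<or> (\<exists>m\<in>{1..l}. [psize x = \<alpha> m] (mod \<eta>))) \<and>
     (\<forall>x\<in>set xs. \<not> overlined x \<longrightarrow> \<eta> dvd psize x) \<and>
     (\<forall>i. i + k \<le> length xs \<longrightarrow>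
        xs ! i \<ge> shift_part (xs ! (i + k - 1)) \<eta> \<and>
        (\<not> overlined (xs ! i) \<longrightarrow> xs ! i > shift_part (xs ! (i + k - 1)) \<eta>)) \<and>
     int (length (filter (\<lambda>x. x \<le> Part \<eta> False) xs)) \<le> int r - 1 \<and>
     (\<forall>i. i + k \<le> length xs + 1 \<longrightarrow>
        xs ! i \<le> shift_part (xs ! (i + k - 2)) \<eta> \<longrightarrow>
        (overlined (xs ! i) \<longrightarrow> xs ! i < shift_part (xs ! (i + k - 2)) \<eta>) \<longrightarrow>
        [int (\<Sum>m = i..i + k - 2. psize (xs ! m) div \<eta>) =
           int r - 1 + int (Vbar xs (xs ! i))] (mod (2 - int j)))}"

definition Bbar :: "nat \<Rightarrow> nat \<Rightarrow> (nat \<Rightarrow> nat) \<Rightarrow> nat \<Rightarrow> nat \<Rightarrow> nat \<Rightarrow> nat \<Rightarrow> nat" where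
  "Bbar j l \<alpha> \<eta> k r n = card (Bbar_set j l \<alpha> \<eta> k r n)"


section \<open>Bressoud's partition function\<close>

definition is_partition :: "nat \<Rightarrow> nat list \<Rightarrow> bool" where
  "is_partition n xs \<longleftrightarrow> sorted_wrt (\<ge>) xs \<and> (\<forall>x\<in>set xs. 0 < x) \<and> sum_list xs = n"

definition V_nondiv :: "nat \<Rightarrow> nat list \<Rightarrow> nat \<Rightarrow> nat" where
  "V_nondiv \<eta> xs N = length (filter (\<lambda>x. x \<le> N \<and> \<not> \<eta> dvd x) xs)"

definition Bress_set ::
  "nat \<Rightarrow> nat \<Rightarrow> (nat \<Rightarrow> nat) \<Rightarrow> nat \<Rightarrow> nat \<Rightarrow> nat \<Rightarrow> nat \<Rightarrow> nat list set" where
  "Bress_set j l \<alpha> \<eta> k r n = {xs. is_partition n xs \<and>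
     (\<forall>x\<in>set xs. [x = 0] (mod \<eta>) \<or> (\<exists>m\<in>{1..l}. [x = \<alpha> m] (mod \<eta>))) \<and>
     distinct (filter (\<lambda>x. \<not> \<eta> dvd x) xs) \<and>
     (\<forall>i. i + k \<le> length xs \<longrightarrow>
        xs ! i \<ge> xs ! (i + k - 1) + \<eta> \<and>
        (\<eta> dvd xs ! i \<longrightarrow> xs ! i > xs ! (i + k - 1) + \<eta>)) \<and>
     int (length (filter (\<lambda>x. x \<le> \<eta>) xs)) \<le> int r - 1 \<and>
     (\<forall>i. i + k \<le> length xs + 1 \<longrightarrow>
        xs ! i \<le> xs ! (i + k - 2) + \<eta> \<longrightarrow>
        (\<not> \<eta> dvd xs ! i \<longrightarrow> xs ! i < xs ! (i + k - 2) + \<eta>) \<longrightarrow>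
        [int (\<Sum>m = i..i + k - 2. xs ! m div \<eta>) =
           int r - 1 + int (V_nondiv \<eta> xs (xs ! i))] (mod (2 - int j)))}"

definition Bress :: "nat \<Rightarrow> nat \<Rightarrow> (nat \<Rightarrow> nat) \<Rightarrow> nat \<Rightarrow> nat \<Rightarrow> nat \<Rightarrow> nat \<Rightarrow> nat" where
  "Bress j l \<alpha> \<eta> k r n = card (Bress_set j l \<alpha> \<eta> k r n)"

text \<open>Cardinalities of infinite sets are 0 by convention; the sets counted above are finite.\<close>

lemma partition_length: "(\<forall>x\<in>set xs. 0 < x) \<Longrightarrow> length xs \<le> sum_list (xs :: nat list)"
  by (induction xs) auto

lemma finite_Bress_set: "finite (Bress_set j l \<alpha> \<eta> k r n)"
proof (rule finite_subset)
  show "Bress_set j l \<alpha> \<eta> k r n \<subseteq> {xs. set xs \<subseteq> {..n} \<and> length xs \<le> n}"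
  proof safe
    fix xs assume "xs \<in> Bress_set j l \<alpha> \<eta> k r n"
    hence pos: "\<forall>x\<in>set xs. 0 < x" and n: "sum_list xs = n"
      unfolding Bress_set_def is_partition_def by blast+
    from partition_length[OF pos] n show "length xs \<le> n" by simp
    fix x assume "x \<in> set xs"
    thus "x \<le> n" using n member_le_sum_list[of x xs] by simp
  qed
qed (simp add: finite_lists_length_le)

lemma finite_Bbar_set: "finite (Bbar_set j l \<alpha> \<eta> k r n)"
proof (rule finite_subset)
  let ?A = "(\<lambda>(m, b). Part m b) ` ({..n} \<times> UNIV)"
  show "Bbar_set j l \<alpha> \<eta> k r n \<subseteq> {xs. set xs \<subseteq> ?A \<and> length xs \<le> n}"
  proof safe
    fix xs assume "xs \<in> Bbar_set j l \<alpha> \<eta> k r n"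
    hence pos: "\<forall>x\<in>set xs. 0 < psize x" and n: "sum_list (map psize xs) = n"
      unfolding Bbar_set_def overpartition_def by blast+
    from partition_length[of "map psize xs"] pos n show "length xs \<le> n" by auto
    fix x assume "x \<in> set xs"
    hence "psize x \<le> n" using n member_le_sum_list[of "psize x" "map psize xs"] by auto
    thus "x \<in> ?A" by (cases x) auto
  qed
  show "finite {xs. set xs \<subseteq> ?A \<and> length xs \<le> n}" by (intro finite_lists_length_le) auto
qed


section \<open>The infinite q-Pochhammer symbol for formal power series\<close>

text \<open>The product is taken in the metric topology of formal power series, where convergence
  means that every coefficient is eventually constant.\<close>

definition qpoch_inf :: "int fps \<Rightarrow> int fps \<Rightarrow> int fps" where
  "qpoch_inf a q = (\<Prod>i. 1 - a * q ^ i)"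

lemma has_prod_qpoch_inf:
  assumes a: "fps_nth a 0 = 0" and q: "fps_nth q 0 = 0"
  shows "(\<lambda>i. 1 - a * q ^ i) has_prod qpoch_inf a q"
proof -
  define P where "P n = (\<Prod>i\<le>n. 1 - a * q ^ i)" for n
  define p where "p = Abs_fps (\<lambda>m. fps_nth (P m) m)"
  have step: "fps_nth (P (Suc n)) m = fps_nth (P n) m" if "m \<le> n" for n m
  proof -
    have z: "fps_nth (q ^ Suc n) l = 0" if "l < Suc n" for l
      using startsby_zero_power_prefix[OF q] that by blast
    have "fps_nth (P n * a * q ^ Suc n) m = 0"
      unfolding fps_mult_nth[of "P n * a"] using \<open>m \<le> n\<close>
      by (intro sum.neutral ballI) (auto simp: z simp del: power_Suc)
    moreover have "P (Suc n) = P n - P n * a * q ^ Suc n"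
      unfolding P_def by (simp add: algebra_simps)
    ultimately show ?thesis by simp
  qed
  have stab: "fps_nth (P n) m = fps_nth (P m) m" if "m \<le> n" for n m
    using that by (induction n rule: dec_induct) (auto simp: step)
  have lim: "P \<longlonglongrightarrow> p"
  proof (rule tendsto_fpsI)
    fix m show "eventually (\<lambda>n. fps_nth (P n) m = fps_nth p m) sequentially"
      unfolding p_def fps_nth_Abs_fps by (rule eventually_sequentiallyI[of m]) (rule stab)
  qed
  have "fps_nth p 0 = 1" using a by (simp add: p_def P_def)
  hence "p \<noteq> 0" by auto
  with lim have "(\<lambda>i. 1 - a * q ^ i) has_prod p"
    by (simp add: has_prod_def raw_has_prod_def P_def[abs_def])
  thus ?thesis using has_prod_unique unfolding qpoch_inf_def by metis
qed

end

(*
  Forget which multiples of \<eta> are overlined, and let \<nu> be the resulting multiset of sizes. For fixed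
  \<nu>, the admissible overlinings M are in bijection with the sets S such that removing one copy of
  t\<eta> for every t in S leaves a partition counted by B_1(k - 1); the parts of S then account for the
  factor (-q^\<eta>; q^\<eta>)_\<infinity>.

  For a window of k - 1 parts at level t, condition (5) asks that the number
  E(t) = f_t + (t - 1)(k - 1) + r - 1 + V_t be even, where
  f_t is the number of non-overlined parts t\<eta> and V_t the number of overlined parts below t\<eta>.
  So windows at level t may hold k - 1 parts if E(t) is even but only k - 2 if it is odd. Let S consist
  of the t with t\<eta> in \<nu> and E(t) even. Removing one copy at these levels makes the capacity k - 2
  everywhere, which is the B_1(k - 1) condition; the closed windows, spanning two levels, are handled by
  the congruence between the slack of such a window and E(t) - E(t - 1). Since E(t) depends only on the
  overlining up to level t, and for t\<eta> in \<nu> its parity flips with the mark at t, S determines M.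
*)
theory Submission
  imports Defs
begin

section \<open>Windows in sorted lists\<close>

text \<open>The conditions are stated at parts that occur, but removing copies changes which parts
  occur. So both sides are first rewritten as bounds at every level t and every size from \<eta> on.
  This works because a window without a multiple of \<eta> holds at most \<open>l\<close> \<le> k -
  2 parts and is never too full.

  Closed windows are the obstacle: (5) lowers their capacity by the parity of E at the upper end,
  while the removal acts at both ends. If such a window holds exactly k - 1 parts, then E(t) and E(t
  - 1) have equal parity, so the lost unit may be charged to either end.

  The bound on the parts \<le> \<eta> fits in by means of k - r virtual copies of the size 0: it
  becomes the bound on the closed window from level 0 to level 1, and E(0) = r - k has the parity of
  their number. The removal takes one virtual copy too, if there is one. For r = k there is none, so
  r = k and r = k - 1 lead to the same right-hand side; hence \<open>min r (k - 1)\<close>, which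
  treats both identities as one.\<close>

lemma sum_list_map_filter_index:
  "sum_list (map w (filter P xs)) = (\<Sum>j\<in>{j. j < length xs \<and> P (xs ! j)}. w (xs ! j) :: 'b::comm_monoid_add)"
proof (induction xs rule: rev_induct)
  case (snoc x xs)
  have *: "{j. j < length (xs @ [x]) \<and> P ((xs @ [x]) ! j)} =
    {j. j < length xs \<and> P (xs ! j)} \<union> (if P x then {length xs} else {})"
    by (auto simp: nth_append less_Suc_eq)
  have "(\<Sum>j\<in>{j. j < length xs \<and> P (xs ! j)}. w ((xs @ [x]) ! j)) = (\<Sum>j\<in>{j. j < length xs \<and> P (xs ! j)}. w (xs ! j))"
    by (rule sum.cong) (auto simp: nth_append)
  then show ?case unfolding * using snoc
    by (subst sum.union_disjoint) auto
qed simp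

text \<open>\<open>C x y\<close> is read as: y is close to x. In a decreasing list the window is the
  longest run from the first occurrence of x whose last entry is still close to x. It depends only
  on x and the entries, which frees (3) and (5) from indices.\<close>

definition window :: "('a::linorder \<Rightarrow> 'a \<Rightarrow> bool) \<Rightarrow> 'a list \<Rightarrow> 'a \<Rightarrow> 'a list" where
  "window C xs x = filter (\<lambda>y. y \<le> x \<and> C x y) xs"

definition window_index :: "('a::linorder \<Rightarrow> 'a \<Rightarrow> bool) \<Rightarrow> 'a list \<Rightarrow> 'a \<Rightarrow> nat set" where
  "window_index C xs x = {j. j < length xs \<and> xs ! j \<le> x \<and> C x (xs ! j)}"

lemma length_window: "length (window C xs x) = card (window_index C xs x)"
  by (simp add: window_def window_index_def length_filter_conv_card)

lemma finite_window_index [simp]: "finite (window_index C xs x)"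
  by (simp add: window_index_def)

context
  fixes C :: "'a::linorder \<Rightarrow> 'a \<Rightarrow> bool" and xs :: "'a list"
  assumes sorted: "sorted_wrt (\<ge>) xs"
    and refl: "\<And>x. C x x"
    and mono: "\<And>x y y'. y \<le> y' \<Longrightarrow> C x y \<Longrightarrow> C x y'"
begin

lemma antimono_nth: "i \<le> j \<Longrightarrow> j < length xs \<Longrightarrow> xs ! j \<le> xs ! i"
  using sorted by (cases "i = j") (auto simp: sorted_wrt_iff_nth_less)

lemma window_index_superset:
  assumes "i + m \<le> length xs" "1 \<le> m" "C (xs ! i) (xs ! (i + m - 1))"
  shows "{i..<i + m} \<subseteq> window_index C xs (xs ! i)"
proof
  fix j assume j: "j \<in> {i..<i + m}"
  have "xs ! (i + m - 1) \<le> xs ! j" "xs ! j \<le> xs ! i"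
    using j assms by (intro antimono_nth; force)+
  then show "j \<in> window_index C xs (xs ! i)"
    using assms j mono by (auto simp: window_index_def)
qed

lemma window_index_interval:
  assumes "x \<in> set xs"
  obtains i where "xs ! i = x" "window_index C xs x = {i..<i + length (window C xs x)}"
    "i + length (window C xs x) \<le> length xs" "1 \<le> length (window C xs x)"
    "\<And>m. 1 \<le> m \<Longrightarrow> m \<le> length (window C xs x) \<Longrightarrow> C x (xs ! (i + m - 1))"
proof -
  let ?J = "window_index C xs x"
  obtain j where j: "j < length xs" "xs ! j = x" using assms by (auto simp: in_set_conv_nth)
  then have jJ: "j \<in> ?J" using refl by (auto simp: window_index_def)
  define i where "i = Min ?J"
  have iJ: "i \<in> ?J" and ij: "i \<le> j" using jJ unfolding i_def by (auto intro: Min_in)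
  have xi: "xs ! i = x"
    using antimono_nth[OF ij j(1)] iJ j by (auto simp: window_index_def)
  define u where "u = Max ?J"
  have uJ: "u \<in> ?J" using jJ unfolding u_def by (auto intro: Max_in)
  have Jiu: "?J = {i..u}"
  proof safe
    fix a assume "a \<in> ?J" then show "a \<in> {i..u}" by (auto simp: i_def u_def)
  next
    fix a assume a: "a \<in> {i..u}"
    have "xs ! a \<le> xs ! i" "xs ! u \<le> xs ! a"
      using a uJ by (auto intro!: antimono_nth simp: window_index_def)
    then show "a \<in> ?J" using uJ a xi mono by (auto simp: window_index_def)
  qed
  have iu: "i \<le> u" using iJ by (simp add: u_def)
  have len: "length (window C xs x) = Suc u - i" by (simp add: length_window Jiu)
  have J: "?J = {i..<i + length (window C xs x)}" "1 \<le> length (window C xs x)"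
    using iu unfolding len Jiu by auto
  have "i + length (window C xs x) - 1 \<in> ?J" using J by auto
  then have "i + length (window C xs x) \<le> length xs" using J(2) by (auto simp: window_index_def)
  moreover have "C x (xs ! (i + m - 1))" if "1 \<le> m" "m \<le> length (window C xs x)" for m
  proof -
    have "i + m - 1 \<in> ?J" unfolding J using that by auto
    then show ?thesis by (simp add: window_index_def)
  qed
  ultimately show ?thesis by (intro that[of i] xi J) auto
qed

text \<open>A run of \<open>m\<close> entries from x on with close ends lies in the window of x.
  Conversely that window is a run starting at a copy of x, so a window of \<open>m\<close> or more
  entries violates the index condition.\<close>

lemma windows_bounded_iff:
  assumes "1 \<le> m"
  shows "(\<forall>i. i + m \<le> length xs \<longrightarrow> \<not> C (xs ! i) (xs ! (i + m - 1))) \<longleftrightarrow>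
         (\<forall>x\<in>set xs. length (window C xs x) < m)" (is "?A \<longleftrightarrow> ?B")
proof
  assume A: ?A
  show ?B
  proof (rule ballI, rule ccontr)
    fix x assume x: "x \<in> set xs" and "\<not> length (window C xs x) < m"
    with window_index_interval[OF x] assms A show False
      by (metis add_le_cancel_left le_trans not_less)
  qed
next
  assume B: ?B
  show ?A
  proof (intro allI impI notI)
    fix i assume i: "i + m \<le> length xs" and C: "C (xs ! i) (xs ! (i + m - 1))"
    have "m \<le> card (window_index C xs (xs ! i))"
      using card_mono[OF _ window_index_superset[OF i assms C]] by simp
    moreover have "xs ! i \<in> set xs" using i assms by simp
    ultimately show False using B by (auto simp: length_window)
  qed
qed

text \<open>As no window exceeds \<open>m\<close>, a run of \<open>m\<close> entries with close ends
  is the entire window of its first entry. So a sum over indices becomes a sum over a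
  window.\<close>

lemma full_windows_iff:
  assumes "1 \<le> m" and le: "\<And>x. x \<in> set xs \<Longrightarrow> length (window C xs x) \<le> m"
  shows "(\<forall>i. i + m \<le> length xs \<longrightarrow> C (xs ! i) (xs ! (i + m - 1)) \<longrightarrow>
            Q (xs ! i) (\<Sum>j = i..i + m - 1. w (xs ! j) :: 'b::comm_monoid_add)) \<longleftrightarrow>
         (\<forall>x\<in>set xs. length (window C xs x) = m \<longrightarrow> Q x (sum_list (map w (window C xs x))))"
    (is "?A \<longleftrightarrow> ?B")
proof -
  have sum: "sum_list (map w (window C xs x)) = (\<Sum>j = i..i + m - 1. w (xs ! j))"
    if "window_index C xs x = {i..<i + m}" for x i
  proof -
    have "{i..<i + m} = {i..i + m - 1}" using \<open>1 \<le> m\<close> by auto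
    with that show ?thesis
      by (simp add: window_def window_index_def sum_list_map_filter_index)
  qed
  show ?thesis
  proof
    assume A: ?A
    show ?B
    proof (intro ballI impI)
      fix x assume "x \<in> set xs" and m: "length (window C xs x) = m"
      then obtain i where i: "xs ! i = x" "window_index C xs x = {i..<i + m}"
        "i + m \<le> length xs" "C x (xs ! (i + m - 1))"
        using window_index_interval[of x] \<open>1 \<le> m\<close> by (metis le_refl)
      show "Q x (sum_list (map w (window C xs x)))"
        using A i sum[OF i(2)] by metis
    qed
  next
    assume B: ?B
    show ?A
    proof (intro allI impI)
      fix i assume i: "i + m \<le> length xs" and C: "C (xs ! i) (xs ! (i + m - 1))"
      have x: "xs ! i \<in> set xs" using i assms by simp
      have sub: "{i..<i + m} \<subseteq> window_index C xs (xs ! i)"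
        by (rule window_index_superset[OF i \<open>1 \<le> m\<close> C])
      have "card (window_index C xs (xs ! i)) \<le> m" using le[OF x] by (simp add: length_window)
      then have "window_index C xs (xs ! i) = {i..<i + m}"
        using card_seteq[OF _ sub] by simp
      note J = this
      have "length (window C xs (xs ! i)) = m" by (simp add: length_window J)
      with B x sum[OF J] show "Q (xs ! i) (\<Sum>j = i..i + m - 1. w (xs ! j))"
        by metis
    qed
  qed
qed

end

section \<open>The product as a generating function\<close>

text \<open>Expanding the finite products of 1 + q^(\<eta> t) over subsets gives one monomial for
  each set of distinct positive multiples of \<eta>.\<close>

lemma qpoch_nth:
  assumes "0 < \<eta>"
  shows "fps_nth (qpoch_inf (- (fps_X ^ \<eta>)) (fps_X ^ \<eta>)) m =
         int (card {S. finite S \<and> 0 \<notin> S \<and> \<eta> * \<Sum>S = m})"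
proof -
  let ?q = "fps_X ^ \<eta> :: int fps"
  have "(\<lambda>i. 1 - (- ?q) * ?q ^ i) has_prod qpoch_inf (- ?q) ?q"
    using assms by (intro has_prod_qpoch_inf) auto
  moreover have "1 - (- ?q) * ?q ^ i \<noteq> 0" for i
  proof
    assume "1 - (- ?q) * ?q ^ i = 0"
    then have "fps_nth (1 - (- ?q) * ?q ^ i) 0 = 0" by simp
    then show False using assms by simp
  qed
  ultimately have lim: "(\<lambda>n. \<Prod>i\<le>n. 1 - (- ?q) * ?q ^ i) \<longlonglongrightarrow> qpoch_inf (- ?q) ?q"
    by (auto simp: has_prod_def raw_has_prod_def simp del: diff_minus_eq_add)
  have prod: "(\<Prod>i\<le>n. 1 - (- ?q) * ?q ^ i) = (\<Sum>S\<in>Pow {1..Suc n}. fps_X ^ (\<eta> * \<Sum>S))" for n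
  proof -
    have "(\<Prod>i\<le>n. 1 - (- ?q) * ?q ^ i) = (\<Prod>t\<in>{1..Suc n}. ?q ^ t + 1)"
      by (rule prod.reindex_bij_witness[of _ "\<lambda>t. t - 1" Suc]) auto
    also have "\<dots> = (\<Sum>S\<in>Pow {1..Suc n}. \<Prod>t\<in>S. ?q ^ t)"
      by (subst prod_add) simp_all
    also have "\<dots> = (\<Sum>S\<in>Pow {1..Suc n}. fps_X ^ (\<eta> * \<Sum>S))"
      by (intro sum.cong) (auto simp: power_sum power_mult)
    finally show ?thesis .
  qed
  have "eventually (\<lambda>n. fps_nth (\<Prod>i\<le>n. 1 - (- ?q) * ?q ^ i) m = fps_nth (qpoch_inf (- ?q) ?q) m) sequentially"
    using lim unfolding tendsto_fps_iff by blast
  then obtain n0 where n0: "\<And>n. n \<ge> n0 \<Longrightarrow> fps_nth (\<Prod>i\<le>n. 1 - (- ?q) * ?q ^ i) m = fps_nth (qpoch_inf (- ?q) ?q) m"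
    by (auto simp: eventually_sequentially)
  \<comment> \<open>From \<open>n0\<close> on the coefficient is constant, and from \<open>m\<close>
    on the range \<open>{1..Suc n}\<close> contains every set of weight \<open>m\<close>.\<close>
  define n where "n = max n0 m"
  have "fps_nth (qpoch_inf (- ?q) ?q) m = (\<Sum>S\<in>Pow {1..Suc n}. of_bool (\<eta> * \<Sum>S = m))"
  proof -
    have "fps_nth (\<Sum>S\<in>Pow {1..Suc n}. fps_X ^ (\<eta> * \<Sum>S) :: int fps) m = fps_nth (qpoch_inf (- ?q) ?q) m"
      using n0[of n] unfolding prod by (simp add: n_def)
    then show ?thesis by (simp add: fps_sum_nth of_bool_def eq_commute[of m])
  qed
  also have "\<dots> = int (card {S \<in> Pow {1..Suc n}. \<eta> * \<Sum>S = m})"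
    by (simp add: of_bool_def sum.If_cases Int_def del: sum_mult_of_bool_eq)
  also have "{S \<in> Pow {1..Suc n}. \<eta> * \<Sum>S = m} = {S. finite S \<and> 0 \<notin> S \<and> \<eta> * \<Sum>S = m}"
  proof -
    have "t \<in> {1..Suc n}" if S: "finite S" "0 \<notin> S" "\<eta> * \<Sum>S = m" "t \<in> S" for S t
    proof -
      have "t \<le> \<Sum>S" using S member_le_sum[of t S "\<lambda>x. x"] by simp
      also have "\<dots> \<le> \<eta> * \<Sum>S" using assms by simp
      also have "\<dots> \<le> Suc n" by (simp add: S(3) n_def)
      finally show ?thesis using S by (cases t) auto
    qed
    then show ?thesis by (auto intro: finite_subset)
  qed
  finally show ?thesis .
qed

section \<open>Overpartitions as multisets with marks\<close>

lemma part_eq_iff: "x = y \<longleftrightarrow> psize x = psize y \<and> overlined x = overlined y"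
  by (auto intro: part.expand)

lemma length_filter_psize:
  "length (filter (\<lambda>x. Q (psize x)) xs) = size (filter_mset Q (mset (map psize xs)))"
  by (induction xs) auto

lemma cong_2_iff_even: "a - b = p - 2 * c \<Longrightarrow> [a = b] (mod 2) \<longleftrightarrow> even p" for a b c p :: int
  by (simp only: cong_iff_dvd_diff) simp

lemma length_filter_split:
  "length (filter P xs) = length (filter (\<lambda>x. P x \<and> Q x) xs) + length (filter (\<lambda>x. P x \<and> \<not> Q x) xs)"
  by (induction xs) auto

lemma length_filter_eq_distinct:
  "distinct xs \<Longrightarrow> length (filter (\<lambda>y. y = a) xs) = of_bool (a \<in> set xs)"
  by (induction xs) auto

text \<open>Condition (3) says that \<open>near\<close> fails for parts at distance $k-1$, and condition (5) concerns
  the parts at distance $k-2$ for which it holds.\<close>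
definition near :: "nat \<Rightarrow> part \<Rightarrow> part \<Rightarrow> bool" where
  "near \<eta> x y \<longleftrightarrow> x < shift_part y \<eta> \<or> \<not> overlined x \<and> x \<le> shift_part y \<eta>"

lemma near_refl: "0 < \<eta> \<Longrightarrow> near \<eta> x x"
  by (auto simp: near_def shift_part_def less_part_def)

lemma near_mono: "y \<le> y' \<Longrightarrow> near \<eta> x y \<Longrightarrow> near \<eta> x y'"
  by (auto simp: near_def shift_part_def less_part_def less_eq_part_def)

lemma Bbar_windows_iff:
  assumes sorted: "sorted_wrt (\<ge>) xs" and "0 < \<eta>" "2 \<le> k"
  shows "(\<forall>i. i + k \<le> length xs \<longrightarrow>
        xs ! i \<ge> shift_part (xs ! (i + k - 1)) \<eta> \<and>
        (\<not> overlined (xs ! i) \<longrightarrow> xs ! i > shift_part (xs ! (i + k - 1)) \<eta>)) \<and>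
     (\<forall>i. i + k \<le> length xs + 1 \<longrightarrow>
        xs ! i \<le> shift_part (xs ! (i + k - 2)) \<eta> \<longrightarrow>
        (overlined (xs ! i) \<longrightarrow> xs ! i < shift_part (xs ! (i + k - 2)) \<eta>) \<longrightarrow>
        [int (\<Sum>m = i..i + k - 2. psize (xs ! m) div \<eta>) =
           int r - 1 + int (Vbar xs (xs ! i))] (mod 2)) \<longleftrightarrow>
     (\<forall>x\<in>set xs. length (window (near \<eta>) xs x) \<le> k - 1 \<and>
        (length (window (near \<eta>) xs x) = k - 1 \<longrightarrow>
           [int (\<Sum>y\<leftarrow>window (near \<eta>) xs x. psize y div \<eta>) = int r - 1 + int (Vbar xs x)] (mod 2)))"
    (is "?A \<and> ?B \<longleftrightarrow> ?C")
proof -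
  have less_k: "c < k \<longleftrightarrow> c \<le> k - 1" for c :: nat using assms(3) by auto
  have not_near: "\<not> near \<eta> x y \<longleftrightarrow> shift_part y \<eta> \<le> x \<and> (\<not> overlined x \<longrightarrow> shift_part y \<eta> < x)" for x y
    by (auto simp: near_def not_less not_le)
  have "?A \<longleftrightarrow> (\<forall>i. i + k \<le> length xs \<longrightarrow> \<not> near \<eta> (xs ! i) (xs ! (i + k - 1)))"
    unfolding not_near ..
  also have "\<dots> \<longleftrightarrow> (\<forall>x\<in>set xs. length (window (near \<eta>) xs x) < k)"
    using assms by (intro windows_bounded_iff) (auto intro: near_refl elim: near_mono)
  finally have A: "?A \<longleftrightarrow> (\<forall>x\<in>set xs. length (window (near \<eta>) xs x) \<le> k - 1)"
    unfolding less_k by simp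
  define Q where "Q x s \<longleftrightarrow> [int s = int r - 1 + int (Vbar xs x)] (mod 2)" for x s
  have B: "?B \<longleftrightarrow> (\<forall>i. i + (k - 1) \<le> length xs \<longrightarrow> near \<eta> (xs ! i) (xs ! (i + (k - 1) - 1)) \<longrightarrow>
       Q (xs ! i) (\<Sum>m = i..i + (k - 1) - 1. psize (xs ! m) div \<eta>))"
  proof -
    have "i + k - 2 = i + (k - 1) - 1" "i + k \<le> length xs + 1 \<longleftrightarrow> i + (k - 1) \<le> length xs" for i
      using assms(3) by auto
    moreover have "near \<eta> x y \<longleftrightarrow> x \<le> shift_part y \<eta> \<and> (overlined x \<longrightarrow> x < shift_part y \<eta>)" for x y
      by (auto simp: near_def)
    ultimately show ?thesis unfolding Q_def by (simp only: simp_thms imp_conjL)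
  qed
  show ?thesis
  \<comment> \<open>Turning (5) into a statement about full windows needs all windows to be bounded
    by k - 1, which is (3) itself.\<close>
  proof (cases ?A)
    case True
    have "?B \<longleftrightarrow> (\<forall>x\<in>set xs. length (window (near \<eta>) xs x) = k - 1 \<longrightarrow>
       Q x (sum_list (map (\<lambda>y. psize y div \<eta>) (window (near \<eta>) xs x))))"
      unfolding B using assms True A
      by (intro full_windows_iff) (auto intro: near_refl elim: near_mono)
    with True A show ?thesis unfolding Q_def by blast
  qed (use A in blast)
qed

definition window_size :: "nat \<Rightarrow> nat multiset \<Rightarrow> nat \<Rightarrow> nat" where
  "window_size \<eta> \<nu> z = size {#y \<in># \<nu>. z < y + \<eta> \<and> y \<le> z#}"

text \<open>A non-overlined part is near parts at distance exactly \<eta>, an overlined part is not.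
  So the window of a plain t\<eta> is closed below and may contain multiples of two levels.\<close>

definition closed_window_size :: "nat \<Rightarrow> nat multiset \<Rightarrow> nat \<Rightarrow> nat" where
  "closed_window_size \<eta> \<nu> t = size {#y \<in># \<nu>. t * \<eta> \<le> y + \<eta> \<and> y \<le> t * \<eta>#}"

definition gap_size :: "nat \<Rightarrow> nat multiset \<Rightarrow> nat \<Rightarrow> nat" where
  "gap_size \<eta> \<nu> t = size {#y \<in># \<nu>. t * \<eta> < y \<and> y < Suc t * \<eta>#}"

text \<open>By (2), sizes not divisible by \<eta> are always overlined; \<open>M\<close> supplies
  the overlined multiples.\<close>

definition overlined_below :: "nat \<Rightarrow> nat multiset \<Rightarrow> nat set \<Rightarrow> nat \<Rightarrow> nat" where
  "overlined_below \<eta> \<nu> M t = size {#y \<in># \<nu>. y < t * \<eta> \<and> \<not> \<eta> dvd y#} + card (M \<inter> {..<t})"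

text \<open>In a window of $k-1$ parts that reaches level \<open>t\<close>, the overlined parts of size at least $t\eta$ add
  equally to both sides of congruence (5); what remains is the parity of this number, which depends
  on \<open>t\<close> only.\<close>
definition parity_sum :: "nat \<Rightarrow> nat \<Rightarrow> nat \<Rightarrow> nat multiset \<Rightarrow> nat set \<Rightarrow> nat \<Rightarrow> int" where
  "parity_sum \<eta> k r \<nu> M t = int (count \<nu> (t * \<eta>)) - of_bool (t \<in> M) + (int t - 1) * (int k - 1) + (int r - 1) + int (overlined_below \<eta> \<nu> M t)"

definition marked :: "nat \<Rightarrow> part list \<Rightarrow> nat set" where
  "marked \<eta> xs = {t. Part (t * \<eta>) True \<in> set xs}"

text \<open>An overlined t\<eta> exceeds the plain one, so a marked copy is left out of the parts
  \<le> \<eta> and of the window of a plain t\<eta>. A plain copy exists when the count exceeds the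
  mark.\<close>

definition overlining_ok :: "nat \<Rightarrow> nat \<Rightarrow> nat \<Rightarrow> nat multiset \<Rightarrow> nat set \<Rightarrow> bool" where
  "overlining_ok \<eta> k r \<nu> M \<longleftrightarrow>
     int (size {#y \<in># \<nu>. y \<le> \<eta>#}) - of_bool (1 \<in> M) \<le> int r - 1 \<and>
     (\<forall>z\<in>#\<nu>. (\<eta> dvd z \<longrightarrow> z div \<eta> \<in> M) \<longrightarrow>
        window_size \<eta> \<nu> z \<le> k - 1 \<and> (window_size \<eta> \<nu> z = k - 1 \<longrightarrow> even (parity_sum \<eta> k r \<nu> M (z div \<eta>)))) \<and>
     (\<forall>t. of_bool (t \<in> M) < count \<nu> (t * \<eta>) \<longrightarrow>
        closed_window_size \<eta> \<nu> t - of_bool (t \<in> M) \<le> k - 1 \<and>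
        (closed_window_size \<eta> \<nu> t - of_bool (t \<in> M) = k - 1 \<longrightarrow> even (parity_sum \<eta> k r \<nu> M t)))"

context
  fixes \<eta> :: nat and xs :: "part list"
  assumes eta: "0 < \<eta>"
    and nonov: "\<forall>x\<in>set xs. \<not> overlined x \<longrightarrow> \<eta> dvd psize x"
    and dist: "distinct (filter overlined xs)"
begin

lemma length_filter_overlined_eq:
  "length (filter (\<lambda>y. y = Part z True) xs) = of_bool (Part z True \<in> set xs)"
proof -
  have "filter (\<lambda>y. y = Part z True) xs = filter (\<lambda>y. y = Part z True) (filter overlined xs)"
    by (auto intro: filter_cong)
  also have "length \<dots> = of_bool (Part z True \<in> set (filter overlined xs))"
    using dist by (rule length_filter_eq_distinct)
  finally show ?thesis by simp
qed

lemma overlined_mem_iff: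
  "Part z True \<in> set xs \<longleftrightarrow> z \<in># mset (map psize xs) \<and> (\<eta> dvd z \<longrightarrow> z div \<eta> \<in> marked \<eta> xs)"
proof
  show "Part z True \<in> set xs \<Longrightarrow> z \<in># mset (map psize xs) \<and> (\<eta> dvd z \<longrightarrow> z div \<eta> \<in> marked \<eta> xs)"
    by (force simp: marked_def)
next
  assume A: "z \<in># mset (map psize xs) \<and> (\<eta> dvd z \<longrightarrow> z div \<eta> \<in> marked \<eta> xs)"
  then obtain x where x: "x \<in> set xs" "psize x = z" by auto
  show "Part z True \<in> set xs"
  proof (cases "\<eta> dvd z")
    case False
    then have "x = Part z True" using nonov x by (cases x) auto
    with x show ?thesis by simp
  qed (use A in \<open>simp add: marked_def\<close>)
qed

lemma length_nonoverlined:
  "int (length (filter (\<lambda>y. y = Part (t * \<eta>) False) xs)) =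
     int (count (mset (map psize xs)) (t * \<eta>)) - of_bool (t \<in> marked \<eta> xs)"
proof -
  have "count (mset (map psize xs)) (t * \<eta>) = length (filter (\<lambda>y. psize y = t * \<eta>) xs)"
    by (induction xs) auto
  also have "\<dots> = length (filter (\<lambda>y. y = Part (t * \<eta>) True) xs) + length (filter (\<lambda>y. y = Part (t * \<eta>) False) xs)"
    by (subst length_filter_split[where Q = overlined])
       (intro arg_cong2[where f = "(+)"] arg_cong[where f = length] filter_cong; auto simp: part_eq_iff)
  finally show ?thesis
    unfolding length_filter_overlined_eq by (simp add: marked_def)
qed

lemma nonoverlined_mem_iff:
  "Part z False \<in> set xs \<longleftrightarrow> \<eta> dvd z \<and>
     of_bool (z div \<eta> \<in> marked \<eta> xs) < count (mset (map psize xs)) z"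
proof (cases "\<eta> dvd z")
  case True
  then obtain t where [simp]: "z = t * \<eta>" by (metis dvd_div_mult_self)
  have "Part z False \<in> set xs \<longleftrightarrow> length (filter (\<lambda>y. y = Part (t * \<eta>) False) xs) > 0"
    by (auto simp: filter_empty_conv)
  also have "\<dots> \<longleftrightarrow> of_bool (t \<in> marked \<eta> xs) < count (mset (map psize xs)) (t * \<eta>)"
    using length_nonoverlined[of t] by (cases "t \<in> marked \<eta> xs"; simp only: of_bool_eq if_True if_False; linarith)
  finally show ?thesis using eta by simp
qed (use nonov in auto)

lemma length_overlined_below:
  "length (filter (\<lambda>y. overlined y \<and> psize y < t * \<eta>) xs) = overlined_below \<eta> (mset (map psize xs)) (marked \<eta> xs) t"
proof -
  have "length (filter (\<lambda>y. overlined y \<and> psize y < t * \<eta>) xs) =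
     length (filter (\<lambda>y. (overlined y \<and> psize y < t * \<eta>) \<and> \<eta> dvd psize y) xs) +
     length (filter (\<lambda>y. (overlined y \<and> psize y < t * \<eta>) \<and> \<not> \<eta> dvd psize y) xs)"
    by (rule length_filter_split)
  also have "filter (\<lambda>y. (overlined y \<and> psize y < t * \<eta>) \<and> \<not> \<eta> dvd psize y) xs =
     filter (\<lambda>y. psize y < t * \<eta> \<and> \<not> \<eta> dvd psize y) xs"
    using nonov by (auto intro: filter_cong)
  also have "length \<dots> = size {#y \<in># mset (map psize xs). y < t * \<eta> \<and> \<not> \<eta> dvd y#}"
    by (rule length_filter_psize)
  also have "filter (\<lambda>y. (overlined y \<and> psize y < t * \<eta>) \<and> \<eta> dvd psize y) xs =
     filter (\<lambda>y. psize y < t * \<eta> \<and> \<eta> dvd psize y) (filter overlined xs)"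
    by (auto intro: filter_cong)
  also have "length \<dots> = card (set \<dots>)"
    by (rule distinct_card[OF distinct_filter[OF dist], symmetric])
  also have "set (filter (\<lambda>y. psize y < t * \<eta> \<and> \<eta> dvd psize y) (filter overlined xs)) =
     (\<lambda>s. Part (s * \<eta>) True) ` (marked \<eta> xs \<inter> {..<t})"
  proof safe
    fix x assume x: "x \<in> set (filter (\<lambda>y. psize y < t * \<eta> \<and> \<eta> dvd psize y) (filter overlined xs))"
    then obtain s where "psize x = s * \<eta>" by auto
    then have "x = Part (s * \<eta>) True" using x by (cases x) auto
    with x show "x \<in> (\<lambda>s. Part (s * \<eta>) True) ` (marked \<eta> xs \<inter> {..<t})"
      by (auto simp: marked_def)
  qed (use eta in \<open>auto simp: marked_def\<close>)
  also have "card \<dots> = card (marked \<eta> xs \<inter> {..<t})"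
    using eta by (intro card_image) (auto simp: inj_on_def)
  finally show ?thesis by (simp add: overlined_below_def)
qed

lemma length_window_overlined:
  "length (window (near \<eta>) xs (Part z True)) = window_size \<eta> (mset (map psize xs)) z"
proof -
  have "window (near \<eta>) xs (Part z True) = filter (\<lambda>y. z < psize y + \<eta> \<and> psize y \<le> z) xs"
    unfolding window_def by (intro filter_cong) (auto simp: near_def shift_part_def less_part_def less_eq_part_def)
  then show ?thesis by (simp only: window_size_def length_filter_psize[where Q = "\<lambda>y. z < y + \<eta> \<and> y \<le> z"])
qed

lemma length_window_nonoverlined:
  "length (window (near \<eta>) xs (Part (t * \<eta>) False)) = closed_window_size \<eta> (mset (map psize xs)) t - of_bool (t \<in> marked \<eta> xs)"
proof -
  let ?P = "\<lambda>y. t * \<eta> \<le> psize y + \<eta> \<and> psize y \<le> t * \<eta>"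
  have "length (filter ?P xs) = length (filter (\<lambda>y. y = Part (t * \<eta>) True) xs) + length (window (near \<eta>) xs (Part (t * \<eta>) False))"
  proof -
    have 1: "(?P y \<and> y = Part (t * \<eta>) True) = (y = Part (t * \<eta>) True)" for y
      by auto
    have 2: "(?P y \<and> y \<noteq> Part (t * \<eta>) True) = (y \<le> Part (t * \<eta>) False \<and> near \<eta> (Part (t * \<eta>) False) y)" for y
      by (cases y) (auto simp: near_def shift_part_def less_part_def less_eq_part_def)
    show ?thesis
      using length_filter_split[of ?P xs "\<lambda>y. y = Part (t * \<eta>) True"]
      by (simp only: 1 2 window_def)
  qed
  moreover have "length (filter ?P xs) = closed_window_size \<eta> (mset (map psize xs)) t"
    unfolding closed_window_size_def by (rule length_filter_psize)
  ultimately show ?thesis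
    unfolding length_filter_overlined_eq by (simp add: marked_def)
qed

text \<open>A window reaching level t extends down by at most one level, so its quotients are t - 1
  or t: each part contributes t - 1, and 1 more if its size is at least t\<eta>. The base t - 1 is
  an integer because t may be 0.\<close>

lemma sum_div_window:
  assumes "\<And>y. y \<in> set ys \<Longrightarrow> t * \<eta> \<le> psize y + \<eta> \<and> psize y < Suc t * \<eta>"
  shows "int (\<Sum>y\<leftarrow>ys. psize y div \<eta>) = (int t - 1) * int (length ys) + int (length (filter (\<lambda>y. t * \<eta> \<le> psize y) ys))"
  using assms
proof (induction ys)
  case (Cons y ys)
  have "int (psize y div \<eta>) = int t - 1 + of_bool (t * \<eta> \<le> psize y)"
  proof (cases "t * \<eta> \<le> psize y")
    case True
    then have "psize y div \<eta> = t" using Cons.prems[of y] eta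
      by (intro div_nat_eqI) (auto simp: mult.commute)
    then show ?thesis using True by simp
  next
    case False
    then have "t \<noteq> 0" by (cases t) auto
    then have "psize y div \<eta> = t - 1" using Cons.prems[of y] eta False
      by (intro div_nat_eqI) (auto simp: mult.commute algebra_simps)
    then show ?thesis using False \<open>t \<noteq> 0\<close> by auto
  qed
  with Cons show ?case by (auto simp: algebra_simps)
qed simp

lemma parity_overlined:
  assumes t: "t = z div \<eta>" and len: "length (window (near \<eta>) xs (Part z True)) = k - 1" and k: "1 \<le> k"
  shows "[int (\<Sum>y\<leftarrow>window (near \<eta>) xs (Part z True). psize y div \<eta>) = int r - 1 + int (Vbar xs (Part z True))] (mod 2) \<longleftrightarrow>
     even (parity_sum \<eta> k r (mset (map psize xs)) (marked \<eta> xs) t)"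
proof -
  have z: "t * \<eta> \<le> z" "z < Suc t * \<eta>"
    using eta dividend_less_times_div[of \<eta> z] unfolding t by (auto simp: mult.commute)
  let ?W = "window (near \<eta>) xs (Part z True)"
  define u where "u = length (filter (\<lambda>y. overlined y \<and> t * \<eta> \<le> psize y \<and> psize y \<le> z) xs)"
  have "int (\<Sum>y\<leftarrow>?W. psize y div \<eta>) = (int t - 1) * int (length ?W) + int (length (filter (\<lambda>y. t * \<eta> \<le> psize y) ?W))"
    by (rule sum_div_window)
       (use z in \<open>auto simp: window_def near_def shift_part_def less_part_def less_eq_part_def\<close>)
  moreover have "filter (\<lambda>y. t * \<eta> \<le> psize y) ?W = filter (\<lambda>y. t * \<eta> \<le> psize y \<and> psize y \<le> z) xs"
    unfolding window_def filter_filter using z eta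
    by (intro filter_cong) (auto simp: near_def shift_part_def less_part_def less_eq_part_def)
  moreover have "length (filter (\<lambda>y. t * \<eta> \<le> psize y \<and> psize y \<le> z) xs) = u + length (filter (\<lambda>y. y = Part (t * \<eta>) False) xs)"
    unfolding u_def
  proof (subst length_filter_split[where Q = overlined], intro arg_cong2[where f = "(+)"] arg_cong[where f = length] filter_cong refl)
    fix y assume y: "y \<in> set xs"
    \<comment> \<open>The only multiple of \<eta> between t\<eta> and z is t\<eta>, and
      non-overlined parts are multiples.\<close>
    show "((t * \<eta> \<le> psize y \<and> psize y \<le> z) \<and> \<not> overlined y) = (y = Part (t * \<eta>) False)"
    proof
      assume A: "(t * \<eta> \<le> psize y \<and> psize y \<le> z) \<and> \<not> overlined y"
      then obtain s where s: "psize y = s * \<eta>" using nonov y by fastforce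
      with A z have "t \<le> s" "s < Suc t" using eta
        by (auto simp del: mult_Suc)
          (metis le_less_trans mult_less_cancel2)
      then have "s = t" by simp
      with A s show "y = Part (t * \<eta>) False" by (cases y) auto
    qed (use z in auto)
  qed auto
  moreover have "Vbar xs (Part z True) = length (filter (\<lambda>y. overlined y \<and> psize y < t * \<eta>) xs) + u"
    unfolding Vbar_def u_def using z
    by (subst length_filter_split[where Q = "\<lambda>y. psize y < t * \<eta>"])
       (intro arg_cong2[where f = "(+)"] arg_cong[where f = length] filter_cong;
        auto simp: less_eq_part_def)
  \<comment> \<open>Condition (5) subtracts r - 1 and the overlined parts below t\<eta>, while
    \<open>parity_sum\<close> adds them, hence the multiple of 2. The \<open>u\<close> terms
    cancel.\<close>
  ultimately have "int (\<Sum>y\<leftarrow>?W. psize y div \<eta>) - (int r - 1 + int (Vbar xs (Part z True))) =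
    parity_sum \<eta> k r (mset (map psize xs)) (marked \<eta> xs) t - 2 * (int r - 1 + int (overlined_below \<eta> (mset (map psize xs)) (marked \<eta> xs) t))"
    using k unfolding len length_overlined_below length_nonoverlined parity_sum_def by (simp add: of_nat_diff length_nonoverlined)
  then show ?thesis by (rule cong_2_iff_even)
qed

lemma parity_nonoverlined:
  assumes len: "length (window (near \<eta>) xs (Part (t * \<eta>) False)) = k - 1" and k: "1 \<le> k"
  shows "[int (\<Sum>y\<leftarrow>window (near \<eta>) xs (Part (t * \<eta>) False). psize y div \<eta>) = int r - 1 + int (Vbar xs (Part (t * \<eta>) False))] (mod 2) \<longleftrightarrow>
     even (parity_sum \<eta> k r (mset (map psize xs)) (marked \<eta> xs) t)"
proof -
  let ?W = "window (near \<eta>) xs (Part (t * \<eta>) False)"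
  have "int (\<Sum>y\<leftarrow>?W. psize y div \<eta>) = (int t - 1) * int (length ?W) + int (length (filter (\<lambda>y. t * \<eta> \<le> psize y) ?W))"
    by (rule sum_div_window)
       (use eta in \<open>auto simp: window_def near_def shift_part_def less_part_def less_eq_part_def\<close>)
  moreover have "filter (\<lambda>y. t * \<eta> \<le> psize y) ?W = filter (\<lambda>y. y = Part (t * \<eta>) False) xs"
    unfolding window_def filter_filter using eta
    by (intro filter_cong) (auto simp: near_def shift_part_def less_part_def less_eq_part_def part_eq_iff)
  moreover have "Vbar xs (Part (t * \<eta>) False) = length (filter (\<lambda>y. overlined y \<and> psize y < t * \<eta>) xs)"
    unfolding Vbar_def by (intro arg_cong[where f = length] filter_cong) (auto simp: less_eq_part_def)
  ultimately have "int (\<Sum>y\<leftarrow>?W. psize y div \<eta>) - (int r - 1 + int (Vbar xs (Part (t * \<eta>) False))) =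
    parity_sum \<eta> k r (mset (map psize xs)) (marked \<eta> xs) t - 2 * (int r - 1 + int (overlined_below \<eta> (mset (map psize xs)) (marked \<eta> xs) t))"
    using k unfolding len length_overlined_below length_nonoverlined parity_sum_def by (simp add: of_nat_diff length_nonoverlined)
  then show ?thesis by (rule cong_2_iff_even)
qed

lemma length_small_parts:
  "int (length (filter (\<lambda>x. x \<le> Part \<eta> False) xs)) =
   int (size {#y \<in># mset (map psize xs). y \<le> \<eta>#}) - of_bool (1 \<in> marked \<eta> xs)"
proof -
  have "length (filter (\<lambda>y. psize y \<le> \<eta>) xs) = length (filter (\<lambda>y. y = Part \<eta> True) xs) + length (filter (\<lambda>x. x \<le> Part \<eta> False) xs)"
    by (subst length_filter_split[where Q = "\<lambda>y. y = Part \<eta> True"])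
       (intro arg_cong2[where f = "(+)"] arg_cong[where f = length] filter_cong;
        auto simp: less_eq_part_def part_eq_iff)
  moreover have "length (filter (\<lambda>y. psize y \<le> \<eta>) xs) = size {#y \<in># mset (map psize xs). y \<le> \<eta>#}"
    by (rule length_filter_psize)
  ultimately show ?thesis
    unfolding length_filter_overlined_eq by (simp add: marked_def)
qed

lemma windows_iff_overlining_ok:
  assumes k: "1 \<le> k"
  shows "int (length (filter (\<lambda>x. x \<le> Part \<eta> False) xs)) \<le> int r - 1 \<and>
     (\<forall>x\<in>set xs. length (window (near \<eta>) xs x) \<le> k - 1 \<and>
        (length (window (near \<eta>) xs x) = k - 1 \<longrightarrow>
           [int (\<Sum>y\<leftarrow>window (near \<eta>) xs x. psize y div \<eta>) = int r - 1 + int (Vbar xs x)] (mod 2))) \<longleftrightarrow>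
     overlining_ok \<eta> k r (mset (map psize xs)) (marked \<eta> xs)"
proof -
  define P where "P x \<longleftrightarrow> length (window (near \<eta>) xs x) \<le> k - 1 \<and>
        (length (window (near \<eta>) xs x) = k - 1 \<longrightarrow>
           [int (\<Sum>y\<leftarrow>window (near \<eta>) xs x. psize y div \<eta>) = int r - 1 + int (Vbar xs x)] (mod 2))" for x
  let ?\<nu> = "mset (map psize xs)" and ?M = "marked \<eta> xs"
  have P1: "P (Part z True) \<longleftrightarrow> window_size \<eta> ?\<nu> z \<le> k - 1 \<and> (window_size \<eta> ?\<nu> z = k - 1 \<longrightarrow> even (parity_sum \<eta> k r ?\<nu> ?M (z div \<eta>)))" for z
    unfolding P_def using parity_overlined[OF refl, of z k r] k length_window_overlined[of z] by metis
  have P2: "P (Part (t * \<eta>) False) \<longleftrightarrow> closed_window_size \<eta> ?\<nu> t - of_bool (t \<in> ?M) \<le> k - 1 \<and> (closed_window_size \<eta> ?\<nu> t - of_bool (t \<in> ?M) = k - 1 \<longrightarrow> even (parity_sum \<eta> k r ?\<nu> ?M t))" for t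
    unfolding P_def using parity_nonoverlined[of t k r] k length_window_nonoverlined[of t] by metis
  have "(\<forall>x\<in>set xs. P x) \<longleftrightarrow> (\<forall>z. Part z True \<in> set xs \<longrightarrow> P (Part z True)) \<and> (\<forall>z. Part z False \<in> set xs \<longrightarrow> P (Part z False))"
    by (metis (full_types) part.exhaust_sel)
  also have "(\<forall>z. Part z False \<in> set xs \<longrightarrow> P (Part z False)) \<longleftrightarrow>
     (\<forall>t. of_bool (t \<in> ?M) < count ?\<nu> (t * \<eta>) \<longrightarrow> P (Part (t * \<eta>) False))"
    (is "?L \<longleftrightarrow> ?R")
  proof
    assume ?L
    then show ?R using eta by (simp add: nonoverlined_mem_iff)
  next
    assume R: ?R
    show ?L
    proof (intro allI impI)
      fix z assume "Part z False \<in> set xs"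
      then have "\<eta> dvd z" and *: "of_bool (z div \<eta> \<in> ?M) < count ?\<nu> z"
        unfolding nonoverlined_mem_iff by blast+
      then have "z div \<eta> * \<eta> = z" by simp
      with R * show "P (Part z False)" by metis
    qed
  qed
  also have "(\<forall>z. Part z True \<in> set xs \<longrightarrow> P (Part z True)) \<longleftrightarrow>
     (\<forall>z\<in>#?\<nu>. (\<eta> dvd z \<longrightarrow> z div \<eta> \<in> ?M) \<longrightarrow> P (Part z True))"
    unfolding overlined_mem_iff by blast
  finally show ?thesis
    unfolding P1 P2 length_small_parts overlining_ok_def P_def[symmetric] by blast
qed

end

section \<open>The window conditions\<close>

lemma size_filter_mset_mono:
  "(\<And>x. x \<in># M \<Longrightarrow> P x \<Longrightarrow> Q x) \<Longrightarrow> size (filter_mset P M) \<le> size (filter_mset Q M)"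
  by (induction M) auto

lemma size_filter_mset_eq: "size {#x \<in># M. x = a#} = count M a"
  by (induction M) auto

lemma size_filter_mset_union:
  assumes "\<And>x. x \<in># M \<Longrightarrow> P x \<longleftrightarrow> Q x \<or> R x" "\<And>x. x \<in># M \<Longrightarrow> \<not> (Q x \<and> R x)"
  shows "size (filter_mset P M) = size (filter_mset Q M) + size (filter_mset R M)"
  using assms by (induction M) auto

lemma multiple_eq_iff:
  fixes \<eta> :: nat assumes "\<eta> dvd y" "z < y + \<eta>" "y \<le> z" shows "y = z div \<eta> * \<eta>"
proof -
  obtain s where s: "y = \<eta> * s" using assms by blast
  then have "z div \<eta> = s" using assms by (intro div_nat_eqI) auto
  with s show ?thesis by simp
qed

lemma multiple_in_window: "0 < \<eta> \<Longrightarrow> z < z div \<eta> * \<eta> + \<eta> \<and> z div \<eta> * \<eta> \<le> z" for z \<eta> :: nat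
  using dividend_less_times_div[of \<eta> z] by (auto simp: mult.commute)

section \<open>Window sizes and parities, level by level\<close>

lemma window_size_eq:
  assumes "0 < \<eta>"
  shows "window_size \<eta> \<nu> z = size {#y \<in># \<nu>. z < y + \<eta> \<and> y \<le> z \<and> \<not> \<eta> dvd y#} + count \<nu> (z div \<eta> * \<eta>)"
  unfolding window_size_def size_filter_mset_eq[symmetric]
  using multiple_eq_iff[of \<eta> _ z] multiple_in_window[OF assms, of z]
  by (intro size_filter_mset_union) auto

lemma size_filter_mset_le_card:
  assumes "finite A" "\<And>x. x \<in># M \<Longrightarrow> P x \<Longrightarrow> f x \<in> A \<and> count M x \<le> 1"
    "\<And>x y. x \<in># M \<Longrightarrow> y \<in># M \<Longrightarrow> P x \<Longrightarrow> P y \<Longrightarrow> f x = f y \<Longrightarrow> x = y"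
  shows "size (filter_mset P M) \<le> card A"
proof -
  have "size (filter_mset P M) = (\<Sum>x\<in>set_mset (filter_mset P M). count (filter_mset P M) x)"
    by (rule size_multiset_overloaded_eq)
  also have "\<dots> \<le> (\<Sum>x\<in>set_mset (filter_mset P M). 1)"
    using assms(2) by (intro sum_mono) auto
  also have "\<dots> = card {x. x \<in># M \<and> P x}" by simp
  also have "\<dots> \<le> card A"
    using assms by (intro card_inj_on_le[of f]) (auto simp: inj_on_def)
  finally show ?thesis .
qed

text \<open>An interval of length \<eta> meets each residue class once and sizes off the multiples
  of \<eta> occur at most once, so each of the \<open>l\<close> residues contributes at most one
  part. The interval contains a single multiple.\<close>

lemma window_size_le:
  assumes "0 < \<eta>"
    and res: "\<forall>x\<in>#\<nu>. [x = 0] (mod \<eta>) \<or> (\<exists>m\<in>{1..l}. [x = \<alpha> m] (mod \<eta>))"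
    and cnt: "\<forall>x. \<not> \<eta> dvd x \<longrightarrow> count \<nu> x \<le> 1"
  shows "window_size \<eta> \<nu> z \<le> l + count \<nu> (z div \<eta> * \<eta>)"
proof -
  have "size {#y \<in># \<nu>. z < y + \<eta> \<and> y \<le> z \<and> \<not> \<eta> dvd y#} \<le> card ((\<lambda>m. \<alpha> m mod \<eta>) ` {1..l})"
  proof (rule size_filter_mset_le_card[where f = "\<lambda>y. y mod \<eta>"])
    fix x assume "x \<in># \<nu>" "z < x + \<eta> \<and> x \<le> z \<and> \<not> \<eta> dvd x"
    then show "x mod \<eta> \<in> (\<lambda>m. \<alpha> m mod \<eta>) ` {1..l} \<and> count \<nu> x \<le> 1"
      using res cnt by (auto simp: cong_def dvd_eq_mod_eq_0)
  next
    fix x y assume xy: "z < x + \<eta> \<and> x \<le> z \<and> \<not> \<eta> dvd x" "z < y + \<eta> \<and> y \<le> z \<and> \<not> \<eta> dvd y" "x mod \<eta> = y mod \<eta>"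
    have "x = y" if "x \<le> y" "z < x + \<eta>" "y \<le> z" "x mod \<eta> = y mod \<eta>" for x y :: nat
    proof -
      have "\<eta> dvd y - x" using that by (metis mod_eq_dvd_iff_nat)
      moreover have "y - x < \<eta>" using that by simp
      ultimately have "y - x = 0" using nat_dvd_not_less by blast
      with that show ?thesis by simp
    qed
    from this[of x y] this[of y x] xy show "x = y" by (cases "x \<le> y") auto
  qed auto
  also have "\<dots> \<le> card {1..l}" by (rule card_image_le) simp
  finally show ?thesis using window_size_eq[OF assms(1), of \<nu> z] by simp
qed

lemma closed_window_size_Suc: "0 < \<eta> \<Longrightarrow> closed_window_size \<eta> \<nu> (Suc t) = count \<nu> (t * \<eta>) + gap_size \<eta> \<nu> t + count \<nu> (Suc t * \<eta>)"
  unfolding closed_window_size_def gap_size_def size_filter_mset_eq[symmetric] add.assoc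
  by (subst size_filter_mset_union[where Q = "\<lambda>x. x = t * \<eta>" and R = "\<lambda>x. t * \<eta> < x \<and> x < Suc t * \<eta> \<or> x = Suc t * \<eta>"])
    (auto intro!: size_filter_mset_union)

lemma window_size_Suc: "0 < \<eta> \<Longrightarrow> window_size \<eta> \<nu> (Suc t * \<eta>) = gap_size \<eta> \<nu> t + count \<nu> (Suc t * \<eta>)"
  unfolding window_size_def gap_size_def size_filter_mset_eq[symmetric]
  by (rule size_filter_mset_union) auto

text \<open>The window ending just before a multiple starts exactly at the preceding one, so it sees
  all copies of that one and the gap above it.\<close>

lemma window_size_before_Suc: "0 < \<eta> \<Longrightarrow> window_size \<eta> \<nu> (Suc t * \<eta> - 1) = count \<nu> (t * \<eta>) + gap_size \<eta> \<nu> t"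
  unfolding window_size_def gap_size_def size_filter_mset_eq[symmetric]
  by (rule size_filter_mset_union) auto

lemma overlined_below_Suc:
  assumes "0 < \<eta>"
  shows "overlined_below \<eta> \<nu> M (Suc t) = overlined_below \<eta> \<nu> M t + gap_size \<eta> \<nu> t + of_bool (t \<in> M)"
proof -
  have nd: "\<not> \<eta> dvd y" if "t * \<eta> < y" "y < Suc t * \<eta>" for y
    using that assms multiple_eq_iff[of \<eta> y "y - 1"] by (metis dvd_def mult.commute mult_less_cancel2 not_less_eq)
  have "size {#y \<in># \<nu>. y < Suc t * \<eta> \<and> \<not> \<eta> dvd y#} = size {#y \<in># \<nu>. y < t * \<eta> \<and> \<not> \<eta> dvd y#} + gap_size \<eta> \<nu> t"
    unfolding gap_size_def
  proof (rule size_filter_mset_union)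
    fix y
    have "\<eta> dvd t * \<eta>" by simp
    then have "y \<noteq> t * \<eta>" if "\<not> \<eta> dvd y" using that by blast
    then show "y < Suc t * \<eta> \<and> \<not> \<eta> dvd y \<longleftrightarrow> y < t * \<eta> \<and> \<not> \<eta> dvd y \<or> t * \<eta> < y \<and> y < Suc t * \<eta>"
      using nd[of y] by (metis le_add2 less_le_trans linorder_neqE_nat mult_Suc)
  qed auto
  moreover have "M \<inter> {..<Suc t} = (if t \<in> M then insert t (M \<inter> {..<t}) else M \<inter> {..<t})"
    by (auto simp: less_Suc_eq)
  ultimately show ?thesis by (simp add: overlined_below_def)
qed

text \<open>The mark at t enters twice: it lowers the plain copies at t and raises the overlined
  parts below t + 1. Modulo 2 the change is therefore k - 1 minus the size of the closed window from
  level t to the plain copies at t + 1.\<close>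

lemma parity_sum_Suc:
  assumes "0 < \<eta>" "1 \<le> k"
  shows "parity_sum \<eta> k r \<nu> M (Suc t) = parity_sum \<eta> k r \<nu> M t + (int (count \<nu> (Suc t * \<eta>)) - of_bool (Suc t \<in> M))
     - int (count \<nu> (t * \<eta>)) + 2 * of_bool (t \<in> M) + (int k - 1) + int (gap_size \<eta> \<nu> t)"
  unfolding parity_sum_def overlined_below_Suc[OF assms(1)] by (simp add: algebra_simps)

lemma small_parts_eq:
  "0 < \<eta> \<Longrightarrow> 0 \<notin># \<nu> \<Longrightarrow> size {#y \<in># \<nu>. y \<le> \<eta>#} = gap_size \<eta> \<nu> 0 + count \<nu> \<eta>"
  unfolding gap_size_def size_filter_mset_eq[symmetric]
  by (rule size_filter_mset_union) (auto intro: gr0I)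

text \<open>The conditions bind only at parts that are present, but imply the same bounds at all places.
  Taking \<open>N0\<close> virtual copies of the size 0 turns the bound on the parts \<open>\<le> \<eta>\<close> into one of them.
  The number \<open>e t\<close> is the capacity lost at level \<open>t\<close> when a saturated window would violate (5).\<close>
lemma relaxed_windows_iff:
  fixes e :: "nat \<Rightarrow> nat" and N0 :: nat and \<nu> :: "nat multiset" and M :: "nat set"
  assumes eta: "0 < \<eta>"
    and res: "\<forall>x\<in>#\<nu>. 0 < x \<and> ([x = 0] (mod \<eta>) \<or> (\<exists>m\<in>{1..l}. [x = \<alpha> m] (mod \<eta>)))"
    and cnt: "\<forall>x. \<not> \<eta> dvd x \<longrightarrow> count \<nu> x \<le> 1"
    and e0: "e 0 = 0" and le: "\<And>t. l + e t \<le> c"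
    and M: "\<And>t. t \<in> M \<Longrightarrow> t * \<eta> \<in># \<nu>"
  defines "N \<equiv> \<lambda>t. if t = 0 then N0 else count \<nu> (t * \<eta>)"
    and "f \<equiv> \<lambda>t. count \<nu> (t * \<eta>) - of_bool (t \<in> M)"
  assumes swap: "\<And>t. N t + gap_size \<eta> \<nu> t + f (Suc t) + e (Suc t) \<le> c \<longleftrightarrow> N t + gap_size \<eta> \<nu> t + f (Suc t) + e t \<le> c"
  shows "N0 + gap_size \<eta> \<nu> 0 + f 1 \<le> c \<and>
     (\<forall>z\<in>#\<nu>. (\<eta> dvd z \<longrightarrow> z div \<eta> \<in> M) \<longrightarrow> window_size \<eta> \<nu> z + e (z div \<eta>) \<le> c) \<and>
     (\<forall>t. of_bool (t \<in> M) < count \<nu> (t * \<eta>) \<longrightarrow> closed_window_size \<eta> \<nu> t - of_bool (t \<in> M) + e t \<le> c) \<longleftrightarrow>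
    (\<forall>t. N t + e t + gap_size \<eta> \<nu> t + f (Suc t) \<le> c) \<and>
    (\<forall>z\<ge>\<eta>. window_size \<eta> \<nu> z + e (z div \<eta>) \<le> c)" (is "?A \<and> ?B \<and> ?C \<longleftrightarrow> ?D \<and> ?E")
proof -
  have count0: "count \<nu> 0 = 0" using res by (metis count_inI less_irrefl)
  have window_size_le: "window_size \<eta> \<nu> z + e (z div \<eta>) \<le> c" if "count \<nu> (z div \<eta> * \<eta>) = 0" for z
    using window_size_le[OF eta _ cnt, of l \<alpha> z] res that le[of "z div \<eta>"] by fastforce
  have closed_window_size: "closed_window_size \<eta> \<nu> (Suc t) - of_bool (Suc t \<in> M) = count \<nu> (t * \<eta>) + gap_size \<eta> \<nu> t + f (Suc t)" for t
    using M[of "Suc t"] unfolding closed_window_size_Suc[OF eta] f_def by (auto simp flip: count_greater_zero_iff)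
  show ?thesis
  proof (intro iffI conjI; (elim conjE)?)
    assume D: ?D and E: ?E
    show ?A using D[rule_format, of 0] e0 by (simp add: N_def)
    show ?B
    proof (intro ballI impI)
      fix z
      show "window_size \<eta> \<nu> z + e (z div \<eta>) \<le> c"
        using E window_size_le[of z] count0 by (cases "\<eta> \<le> z") auto
    qed
    show ?C
    proof (intro allI impI)
      fix t assume t: "of_bool (t \<in> M) < count \<nu> (t * \<eta>)"
      then obtain s where s: "t = Suc s" using count0 by (cases t) auto
      have "count \<nu> (s * \<eta>) \<le> N s" using count0 by (auto simp: N_def)
      \<comment> \<open>The relaxed bound charges the lost unit at the lower end of the closed
        window, (5) at the upper end; \<open>swap\<close> moves it.\<close>
      moreover have "N s + gap_size \<eta> \<nu> s + f t + e t \<le> c"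
        using D[rule_format, of s] swap[of s] s by simp
      ultimately show "closed_window_size \<eta> \<nu> t - of_bool (t \<in> M) + e t \<le> c"
        using closed_window_size[of s] s by simp
    qed
  next
    assume A: ?A and B: ?B and C: ?C
    show E: ?E
    proof (intro allI impI)
      fix z assume z: "\<eta> \<le> z"
      define t where "t = z div \<eta>"
      show "window_size \<eta> \<nu> z + e (z div \<eta>) \<le> c"
      proof (cases "count \<nu> (t * \<eta>) = 0")
        case True
        then show ?thesis using window_size_le[of z] by (simp add: t_def)
      next
        case False
        have tz: "t * \<eta> \<le> z" "z < t * \<eta> + \<eta>" using multiple_in_window[OF eta, of z] by (auto simp: t_def)
        have fin: "finite {y. y \<in># \<nu> \<and> y \<le> z}" by simp
        have mem: "t * \<eta> \<in> {y. y \<in># \<nu> \<and> y \<le> z}" using False tz by (auto simp: count_eq_zero_iff)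
        \<comment> \<open>No part lies above z' and up to z, so moving the end of the window down to
          z' loses no part. The copy of t\<eta> keeps z' on the level of z.\<close>
        define z' where "z' = Max {y. y \<in># \<nu> \<and> y \<le> z}"
        have z': "z' \<in># \<nu>" "z' \<le> z" "t * \<eta> \<le> z'"
        proof -
          have "z' \<in> {y. y \<in># \<nu> \<and> y \<le> z}" using Max_in[OF fin] mem unfolding z'_def by blast
          then show "z' \<in># \<nu>" "z' \<le> z" by auto
          show "t * \<eta> \<le> z'" using Max_ge[OF fin mem] by (simp add: z'_def)
        qed
        have max: "y \<le> z'" if "y \<in># \<nu>" "y \<le> z" for y
          unfolding z'_def using that by (intro Max_ge) auto
        have t': "z' div \<eta> = t"
          using z' tz by (intro div_nat_eqI) (auto simp: mult.commute)
        have "window_size \<eta> \<nu> z \<le> window_size \<eta> \<nu> z'"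
          unfolding window_size_def using max z' by (intro size_filter_mset_mono) fastforce
        moreover have "window_size \<eta> \<nu> z' + e t \<le> c"
        proof (cases "\<eta> dvd z' \<and> t \<notin> M")
          case False
          then show ?thesis using B z' t' by auto
        next
          \<comment> \<open>An unmarked multiple is constrained through its closed window, which
            contains the half-open one.\<close>
          case True
          then have zt: "z' = t * \<eta>" using t' by auto
          have "of_bool (t \<in> M) < count \<nu> (t * \<eta>)" using True z' zt by simp
          with C have "closed_window_size \<eta> \<nu> t - of_bool (t \<in> M) + e t \<le> c" by blast
          then have "closed_window_size \<eta> \<nu> t + e t \<le> c" using True by simp
          moreover have "window_size \<eta> \<nu> z' \<le> closed_window_size \<eta> \<nu> t"
            unfolding window_size_def closed_window_size_def zt by (intro size_filter_mset_mono) auto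
          ultimately show ?thesis by simp
        qed
        ultimately show ?thesis by (simp add: t_def)
      qed
    qed
    show ?D
    proof
      fix t
      show "N t + e t + gap_size \<eta> \<nu> t + f (Suc t) \<le> c"
      proof (cases t)
        case 0
        then show ?thesis using A e0 by (simp add: N_def)
      next
        case (Suc s)
        then have N: "N t = count \<nu> (t * \<eta>)" by (simp add: N_def)
        show ?thesis
        proof (cases "f (Suc t) = 0")
          \<comment> \<open>Without a plain copy at level t + 1 no closed window ends there; the
            bound comes from the half-open window that ends just before that level.\<close>
          case True
          have "t \<le> (Suc t * \<eta> - 1) div \<eta>" "(Suc t * \<eta> - 1) div \<eta> < Suc t" "\<eta> \<le> Suc t * \<eta> - 1"
            using eta Suc by (auto simp: less_eq_div_iff_mult_less_eq div_less_iff_less_mult)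
          then have "window_size \<eta> \<nu> (Suc t * \<eta> - 1) + e t \<le> c" using E by (metis le_antisym less_Suc_eq_le)
          then show ?thesis using True N window_size_before_Suc[OF eta, of \<nu> t] by simp
        next
          case False
          then have "of_bool (Suc t \<in> M) < count \<nu> (Suc t * \<eta>)" by (simp add: f_def)
          with C have "closed_window_size \<eta> \<nu> (Suc t) - of_bool (Suc t \<in> M) + e (Suc t) \<le> c" by blast
          then have "N t + gap_size \<eta> \<nu> t + f (Suc t) + e (Suc t) \<le> c" unfolding closed_window_size N by simp
          then show ?thesis using swap[of t] by simp
        qed
      qed
    qed
  qed
qed

text \<open>F counts the copies at one level plus the lost unit, c the gap; f, g and e are the plain
  copies, the mark and the lost unit at the next level. If no difference is truncated, the two
  bounds read F + c + f \<le> k - 1 and F + c + f + g + e \<le> k. They agree for g + e = 1. For g +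
  e = 0 or 2 they could differ only at F + c + f = k or k - 1 respectively, which the parity
  hypothesis excludes.\<close>

lemma parity_step:
  fixes F f g e n c k :: nat
  assumes "e \<le> 1" "g \<le> 1" "n = f + g" "odd (F + c + f + k - 1) = odd e"  "c + n + e \<le> k - 1" "c + 2 \<le> k"
  shows "F + c + f \<le> k - 1 \<longleftrightarrow> (F - 1) + c + (n + e - 1) \<le> k - 2"
proof -
  obtain k' where k: "k = k' + 2" using assms by (metis le_add_diff_inverse2 add_leD2)
  obtain j where j: "F + c + f + k' + 1 = 2 * j + e"
  proof -
    have "odd (F + c + f + k' + 1) = odd e" using assms(4) by (simp add: k)
    then have "(F + c + f + k' + 1) mod 2 = e"
      using assms(1) by (cases "odd e") (auto simp: mod_2_eq_odd elim: oddE)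
    then have "F + c + f + k' + 1 = 2 * ((F + c + f + k' + 1) div 2) + e"
      using mult_div_mod_eq[of 2 "F + c + f + k' + 1"] by linarith
    then show ?thesis by (rule that)
  qed
  have b: "c + f + g + e \<le> k' + 1" "c \<le> k'" using assms by (auto simp: k)
  have "F + c + f \<le> k' + 1 \<longleftrightarrow> (F - 1) + c + (f + g + e - 1) \<le> k'"
  proof (cases "F = 0 \<or> f + g + e = 0")
    \<comment> \<open>Truncated differences: if F = 0, both sides hold; if f, g and e vanish and F >
      0, both sides are the same inequality.\<close>
    case True
    then show ?thesis using b assms(1,2) by auto
  next
    case False
    then have "F + c + f \<le> k' + 1 \<longleftrightarrow> F + c + (f + g + e) \<le> k' + 2"
    proof -
      define T where "T = F + c + f"
      have T: "T + k' + 1 = 2 * j + e" using j by (simp add: T_def)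
      have "T \<le> k' + 1 \<longleftrightarrow> T + (g + e) \<le> k' + 2"
      proof (cases "e = 0")
        case True
        then have "T \<noteq> k' + 2" using T by presburger
        then show ?thesis using True assms(2) by linarith
      next
        case False
        then have e: "e = 1" using assms(1) by simp
        then have "T \<noteq> k' + 1" using T by presburger
        then show ?thesis using e assms(2) by linarith
      qed
      then show ?thesis by (simp add: T_def ac_simps)
    qed
    also have "\<dots> \<longleftrightarrow> (F - 1) + c + (f + g + e - 1) \<le> k'" using False by linarith
    finally show ?thesis .
  qed
  then show ?thesis using assms(3) by (simp add: k)
qed

section \<open>Bressoud's conditions on multisets and the removal of distinct multiples\<close>

definition bressoud_ok :: "nat \<Rightarrow> nat \<Rightarrow> nat \<Rightarrow> nat multiset \<Rightarrow> bool" where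
  "bressoud_ok \<eta> k r \<mu> \<longleftrightarrow>
     int (size {#y \<in># \<mu>. y \<le> \<eta>#}) \<le> int r - 1 \<and>
     (\<forall>z\<in>#\<mu>. \<not> \<eta> dvd z \<longrightarrow> window_size \<eta> \<mu> z \<le> k - 1) \<and>
     (\<forall>t. t * \<eta> \<in># \<mu> \<longrightarrow> closed_window_size \<eta> \<mu> t \<le> k - 1)"

lemma even_diff_imp: "even (a - b) \<Longrightarrow> even a \<longleftrightarrow> even b" for a b :: int
  by simp

text \<open>The relaxed form with no lost units and no marks. For r < k, the k - r - 1 virtual
  copies turn the bound r - 1 on small parts into k - 2; for r = k, truncation to 0 matches
  \<open>min r (k - 1)\<close> = k - 1.\<close>

lemma bressoud_ok_relaxed:
  assumes eta: "0 < \<eta>" and k: "l + 2 \<le> k" and r: "r \<le> k"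
    and res: "\<forall>x\<in>#\<mu>. 0 < x \<and> ([x = 0] (mod \<eta>) \<or> (\<exists>m\<in>{1..l}. [x = \<alpha> m] (mod \<eta>)))"
    and cnt: "\<forall>x. \<not> \<eta> dvd x \<longrightarrow> count \<mu> x \<le> 1"
  shows "bressoud_ok \<eta> (k - 1) (min r (k - 1)) \<mu> \<longleftrightarrow>
     (\<forall>t. (if t = 0 then k - r - 1 else count \<mu> (t * \<eta>)) + gap_size \<eta> \<mu> t + count \<mu> (Suc t * \<eta>) \<le> k - 2) \<and>
     (\<forall>z\<ge>\<eta>. window_size \<eta> \<mu> z \<le> k - 2)"
proof -
  have 0: "0 \<notin># \<mu>" using res by auto
  have small: "int (size {#y \<in># \<mu>. y \<le> \<eta>#}) \<le> int (min r (k - 1)) - 1 \<longleftrightarrow>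
     (k - r - 1) + gap_size \<eta> \<mu> 0 + count \<mu> \<eta> \<le> k - 2"
    using r k unfolding small_parts_eq[OF eta 0] by auto
  have "k - 1 - 1 = k - 2" and "l \<le> k - 2" using k by simp_all
  then show ?thesis
    using relaxed_windows_iff[OF eta res cnt, of "\<lambda>_. 0" "k - 2" "{}" "k - r - 1"]
    unfolding bressoud_ok_def small
    by (simp only: empty_iff of_bool_eq diff_zero mult_1 add_0_right simp_thms count_greater_zero_iff)
qed

definition multiples :: "nat \<Rightarrow> nat set \<Rightarrow> nat multiset" where
  "multiples \<eta> S = image_mset (\<lambda>t. t * \<eta>) (mset_set S)"

lemma multiple_div: "0 < \<eta> \<Longrightarrow> z < t * \<eta> + \<eta> \<and> t * \<eta> \<le> z \<longleftrightarrow> t = z div \<eta>" for z t \<eta> :: nat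
  using multiple_in_window[of \<eta> z] multiple_eq_iff[of \<eta> "t * \<eta>" z] by auto

lemma size_filter_multiples:
  "finite S \<Longrightarrow> size (filter_mset P (multiples \<eta> S)) = card {t \<in> S. P (t * \<eta>)}"
  by (simp add: multiples_def filter_mset_image_mset)

lemma window_size_multiples: "0 < \<eta> \<Longrightarrow> finite S \<Longrightarrow> window_size \<eta> (multiples \<eta> S) z = of_bool (z div \<eta> \<in> S)"
proof -
  assume "0 < \<eta>" "finite S"
  moreover have "{t \<in> S. t = z div \<eta>} = (if z div \<eta> \<in> S then {z div \<eta>} else {})" by auto
  ultimately show ?thesis
    by (simp add: window_size_def size_filter_multiples multiple_div)
qed

lemma count_multiples: "0 < \<eta> \<Longrightarrow> finite S \<Longrightarrow> count (multiples \<eta> S) (t * \<eta>) = of_bool (t \<in> S)"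
proof -
  assume "0 < \<eta>" "finite S"
  moreover have "{s \<in> S. s = t} = (if t \<in> S then {t} else {})" by auto
  ultimately show ?thesis
    by (simp add: size_filter_mset_eq[symmetric] size_filter_multiples)
qed

lemma gap_size_multiples: "0 < \<eta> \<Longrightarrow> finite S \<Longrightarrow> gap_size \<eta> (multiples \<eta> S) t = 0"
  by (auto simp: gap_size_def size_filter_multiples simp del: mult_Suc)

lemma multiples_subset:
  assumes "0 < \<eta>" "\<And>t. t \<in> S \<Longrightarrow> t * \<eta> \<in># \<nu>" "finite S"
  shows "multiples \<eta> S \<subseteq># \<nu>"
proof (rule mset_subset_eqI)
  fix x
  show "count (multiples \<eta> S) x \<le> count \<nu> x"
  proof (cases "x \<in># multiples \<eta> S")
    case True
    then obtain t where "t \<in> S" "x = t * \<eta>" using assms by (auto simp: multiples_def)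
    then show ?thesis using assms by (auto simp: count_multiples Suc_le_eq)
  qed (simp add: not_in_iff)
qed

lemma window_size_add: "window_size \<eta> (\<mu> + \<nu>) z = window_size \<eta> \<mu> z + window_size \<eta> \<nu> z"
  by (simp add: window_size_def)

lemma gap_size_add: "gap_size \<eta> (\<mu> + \<nu>) t = gap_size \<eta> \<mu> t + gap_size \<eta> \<nu> t"
  by (simp add: gap_size_def)

definition extracted :: "nat \<Rightarrow> nat \<Rightarrow> nat \<Rightarrow> nat multiset \<Rightarrow> nat set \<Rightarrow> nat set" where
  "extracted \<eta> k r \<nu> M = {t. t * \<eta> \<in># \<nu> \<and> even (parity_sum \<eta> k r \<nu> M t)}"

definition positions :: "nat \<Rightarrow> nat multiset \<Rightarrow> nat set" where
  "positions \<eta> \<nu> = {t. t * \<eta> \<in># \<nu>}"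

lemma finite_positions: "0 < \<eta> \<Longrightarrow> finite (positions \<eta> \<nu>)"
proof -
  assume "0 < \<eta>"
  then have "positions \<eta> \<nu> \<subseteq> (\<lambda>z. z div \<eta>) ` set_mset \<nu>" by (force simp: positions_def)
  then show ?thesis by (rule finite_subset) simp
qed

context
  fixes \<eta> l k r :: nat and \<alpha> :: "nat \<Rightarrow> nat" and \<nu> :: "nat multiset" and M :: "nat set"
  assumes eta: "0 < \<eta>" and k: "l + 2 \<le> k" and r: "r \<le> k"
    and res: "\<forall>x\<in>#\<nu>. 0 < x \<and> ([x = 0] (mod \<eta>) \<or> (\<exists>m\<in>{1..l}. [x = \<alpha> m] (mod \<eta>)))"
    and cnt: "\<forall>x. \<not> \<eta> dvd x \<longrightarrow> count \<nu> x \<le> 1"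
    and M: "M \<subseteq> positions \<eta> \<nu>"
begin

text \<open>The capacity lost at level t. It is 0 at level 0 whatever the parity there, as no part
  has size 0.\<close>

private definition bit :: "nat \<Rightarrow> nat" where
  "bit t = (if t = 0 then 0 else of_bool (odd (parity_sum \<eta> k r \<nu> M t)))"

text \<open>The k - r virtual copies at level 0 turn the bound r - 1 on small parts into k - 1, and
  their number has the parity of E(0) = r - k, so the recurrence for E starts correctly.\<close>

private definition mult0 :: "nat \<Rightarrow> nat" where
  "mult0 t = (if t = 0 then k - r else count \<nu> (t * \<eta>))"

private definition plain :: "nat \<Rightarrow> nat" where
  "plain t = count \<nu> (t * \<eta>) - of_bool (t \<in> M)"

private lemma count_zero: "count \<nu> 0 = 0"
  using res by (metis count_inI less_irrefl)

private lemma zero_notin: "0 \<notin> M"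
proof
  assume "0 \<in> M"
  then have "0 \<in># \<nu>" using M by (auto simp: positions_def)
  then show False using res by auto
qed

private lemma of_bool_le_count: "of_bool (t \<in> M) \<le> count \<nu> (t * \<eta>)"
  using M by (auto simp: positions_def Suc_le_eq)

private lemma odd_parity_sum_Suc: "odd (parity_sum \<eta> k r \<nu> M (Suc t)) \<longleftrightarrow> odd (mult0 t + gap_size \<eta> \<nu> t + plain (Suc t) + bit t + (k - 1))"
proof -
  have f: "int (plain t) = int (count \<nu> (t * \<eta>)) - of_bool (t \<in> M)" for t
    using of_bool_le_count[of t] by (simp add: plain_def of_nat_diff)
  have k1: "int k - 1 = int (k - 1)" using k by simp
  have "parity_sum \<eta> k r \<nu> M (Suc t) = parity_sum \<eta> k r \<nu> M t + int (plain (Suc t)) - int (count \<nu> (t * \<eta>)) + 2 * of_bool (t \<in> M) + int (k - 1) + int (gap_size \<eta> \<nu> t)"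
    using parity_sum_Suc[OF eta, of k r \<nu> M t] k by (simp add: f k1[symmetric])
  moreover have "even (parity_sum \<eta> k r \<nu> M t - int (count \<nu> (t * \<eta>)) - int (mult0 t) - int (bit t))"
  proof (cases "t = 0")
    case True
    have "parity_sum \<eta> k r \<nu> M 0 = int r - int k"
      using zero_notin by (simp add: parity_sum_def overlined_below_def count_zero)
    then show ?thesis using True r by (simp add: mult0_def bit_def count_zero of_nat_diff)
  qed (auto simp: mult0_def bit_def)
  ultimately have "even (parity_sum \<eta> k r \<nu> M (Suc t) - int (mult0 t + gap_size \<eta> \<nu> t + plain (Suc t) + bit t + (k - 1)))"
    by auto
  then have "even (parity_sum \<eta> k r \<nu> M (Suc t)) \<longleftrightarrow> even (int (mult0 t + gap_size \<eta> \<nu> t + plain (Suc t) + bit t + (k - 1)))"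
    by (rule even_diff_imp)
  then show ?thesis by (simp only: even_of_nat)
qed

private lemma bit_le_1: "bit t \<le> 1"
  by (simp add: bit_def)

private lemma small_parts_iff:
  "int (size {#y \<in># \<nu>. y \<le> \<eta>#}) - of_bool (1 \<in> M) \<le> int r - 1 \<longleftrightarrow> k - r + gap_size \<eta> \<nu> 0 + plain 1 \<le> k - 1"
proof -
  have "0 \<notin># \<nu>" using count_zero by (simp add: not_in_iff)
  then show ?thesis using of_bool_le_count[of 1] r k
    by (simp add: small_parts_eq[OF eta] plain_def of_nat_diff) linarith
qed

private lemma overlining_ok_iff:
  "overlining_ok \<eta> k r \<nu> M \<longleftrightarrow>
     (\<forall>t. mult0 t + bit t + gap_size \<eta> \<nu> t + plain (Suc t) \<le> k - 1) \<and>
     (\<forall>z\<ge>\<eta>. window_size \<eta> \<nu> z + bit (z div \<eta>) \<le> k - 1)"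
proof -
  have le: "l + bit t \<le> k - 1" for t using bit_le_1[of t] k by linarith
  \<comment> \<open>If the lost units at the two ends differ, the recurrence for E shows that the
    window does not hold exactly k - 1 parts, so the bounds k - 1 and k - 2 are equivalent for
    it.\<close>
  have swap: "mult0 t + gap_size \<eta> \<nu> t + plain (Suc t) + bit (Suc t) \<le> k - 1 \<longleftrightarrow>
      mult0 t + gap_size \<eta> \<nu> t + plain (Suc t) + bit t \<le> k - 1" for t
  proof (cases "bit (Suc t) = bit t")
    case False
    then have sum: "bit t + bit (Suc t) = 1" using bit_le_1[of t] bit_le_1[of "Suc t"] by linarith
    have "mult0 t + gap_size \<eta> \<nu> t + plain (Suc t) \<noteq> k - 1"
    proof
      assume D: "mult0 t + gap_size \<eta> \<nu> t + plain (Suc t) = k - 1"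
      have "odd (bit (Suc t)) \<longleftrightarrow> odd (parity_sum \<eta> k r \<nu> M (Suc t))" by (simp add: bit_def)
      also have "\<dots> \<longleftrightarrow> odd (bit t)" unfolding odd_parity_sum_Suc D by (simp only: even_add) blast
      finally have "odd (bit (Suc t)) \<longleftrightarrow> odd (bit t)" .
      with sum show False by (metis even_add odd_one)
    qed
    then show ?thesis using bit_le_1[of t] bit_le_1[of "Suc t"] False by linarith
  qed simp
  have Mm: "t * \<eta> \<in># \<nu>" if "t \<in> M" for t using M that by (auto simp: positions_def)
  have window_size: "window_size \<eta> \<nu> z \<le> k - 1 \<and> (window_size \<eta> \<nu> z = k - 1 \<longrightarrow> even (parity_sum \<eta> k r \<nu> M (z div \<eta>))) \<longleftrightarrow>
     window_size \<eta> \<nu> z + bit (z div \<eta>) \<le> k - 1" for z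
  proof (cases "z div \<eta> = 0")
    \<comment> \<open>As \<open>bit\<close> is 0 at level 0, the parity condition must never apply
      there: such a window has at most l < k - 1 parts.\<close>
    case True
    then have "window_size \<eta> \<nu> z \<le> l" using window_size_le[OF eta _ cnt, of l \<alpha> z] res count_zero by auto
    then have "window_size \<eta> \<nu> z < k - 1" using k by linarith
    then show ?thesis using True by (simp add: bit_def)
  qed (use k in \<open>auto simp: bit_def\<close>)
  have closed_window_size: "(of_bool (t \<in> M) < count \<nu> (t * \<eta>) \<longrightarrow> w \<le> k - 1 \<and> (w = k - 1 \<longrightarrow> even (parity_sum \<eta> k r \<nu> M t))) \<longleftrightarrow>
     (of_bool (t \<in> M) < count \<nu> (t * \<eta>) \<longrightarrow> w + bit t \<le> k - 1)" for t w
    using count_zero by (cases "t = 0") (auto simp: bit_def)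
  have bit0: "bit 0 = 0" by (simp add: bit_def)
  show ?thesis
    unfolding overlining_ok_def window_size closed_window_size small_parts_iff
    by (rule relaxed_windows_iff[where e = bit and c = "k - 1" and M = M and ?N0.0 = "k - r" and \<nu> = \<nu> and \<eta> = \<eta>,
          folded plain_def mult0_def, OF eta res cnt bit0 le Mm swap])
qed

private abbreviation (input) S :: "nat set" where
  "S \<equiv> extracted \<eta> k r \<nu> M"

private abbreviation (input) \<mu> :: "nat multiset" where
  "\<mu> \<equiv> \<nu> - multiples \<eta> S"

private lemma S_subset: "S \<subseteq> positions \<eta> \<nu>"
  by (auto simp: extracted_def positions_def)

private lemma finite_S: "finite S"
  using S_subset finite_positions[OF eta] by (rule finite_subset)

private lemma split: "\<nu> = \<mu> + multiples \<eta> S"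
proof -
  have "multiples \<eta> S \<subseteq># \<nu>"
    by (rule multiples_subset[OF eta _ finite_S]) (use S_subset in \<open>auto simp: positions_def\<close>)
  then show ?thesis by simp
qed

text \<open>At a level that occurs, either E is even, \<open>bit\<close> is 0 and one copy goes, or
  E is odd, \<open>bit\<close> is 1 and none goes. At an absent level truncation gives 0 in both
  cases.\<close>

private lemma count_mu: "count \<mu> (t * \<eta>) = (if t = 0 then 0 else mult0 t + bit t - 1)"
proof -
  have "count \<mu> (t * \<eta>) = count \<nu> (t * \<eta>) - of_bool (t \<in> S)"
    using count_multiples[OF eta finite_S] by simp
  also have "\<dots> = (if t = 0 then 0 else mult0 t + bit t - 1)"
    by (auto simp: extracted_def mult0_def bit_def count_zero not_in_iff)
  finally show ?thesis .
qed

private lemma gap_size_mu: "gap_size \<eta> \<mu> t = gap_size \<eta> \<nu> t"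
  using gap_size_add[of \<eta> \<mu> "multiples \<eta> S" t] gap_size_multiples[OF eta finite_S] split by simp

private lemma window_size_mu: "window_size \<eta> \<mu> z + of_bool (z div \<eta> \<in> S) = window_size \<eta> \<nu> z"
  using window_size_add[of \<eta> \<mu> "multiples \<eta> S" z] window_size_multiples[OF eta finite_S] split by simp

private lemma bressoud_ok_iff:
  "bressoud_ok \<eta> (k - 1) (min r (k - 1)) \<mu> \<longleftrightarrow>
     (\<forall>t. (mult0 t + bit t - 1) + gap_size \<eta> \<nu> t + (mult0 (Suc t) + bit (Suc t) - 1) \<le> k - 2) \<and>
     (\<forall>z\<ge>\<eta>. window_size \<eta> \<mu> z \<le> k - 2)"
proof -
  have sub: "x \<in># \<nu>" if "x \<in># \<mu>" for x using that by (rule in_diffD)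
  have res': "\<forall>x\<in>#\<mu>. 0 < x \<and> ([x = 0] (mod \<eta>) \<or> (\<exists>m\<in>{1..l}. [x = \<alpha> m] (mod \<eta>)))"
    using res sub by blast
  have cnt': "\<forall>x. \<not> \<eta> dvd x \<longrightarrow> count \<mu> x \<le> 1"
    using cnt by (auto intro: order.trans[OF diff_le_self])
  \<comment> \<open>At level 0 the same formula removes a virtual copy: k - r becomes k - r -
    1.\<close>
  have N: "(if t = 0 then k - r - 1 else count \<mu> (t * \<eta>)) = mult0 t + bit t - 1" for t
    unfolding count_mu by (simp add: mult0_def bit_def)
  have NS: "count \<mu> (Suc t * \<eta>) = mult0 (Suc t) + bit (Suc t) - 1" for t
    using count_mu[of "Suc t"] by simp
  show ?thesis
    unfolding bressoud_ok_relaxed[OF eta k r res' cnt'] N NS gap_size_mu ..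
qed

text \<open>At each level that occurs there is either a lost unit or a removed copy, so the
  half-open windows correspond one by one. The closed ones are compared by
  \<open>parity_step\<close>, which takes the half-open bounds as input.\<close>

lemma overlining_ok_iff_bressoud_ok:
  "overlining_ok \<eta> k r \<nu> M \<longleftrightarrow> bressoud_ok \<eta> (k - 1) (min r (k - 1)) (\<nu> - multiples \<eta> (extracted \<eta> k r \<nu> M))"
proof -
  have window_size: "window_size \<eta> \<nu> z + bit (z div \<eta>) \<le> k - 1 \<longleftrightarrow> window_size \<eta> \<mu> z \<le> k - 2" if "\<eta> \<le> z" for z
  proof -
    have t: "z div \<eta> \<noteq> 0" using that eta by (simp add: div_eq_0_iff)
    show ?thesis
    proof (cases "count \<nu> (z div \<eta> * \<eta>) = 0")
      case True
      then have "window_size \<eta> \<nu> z \<le> l" using window_size_le[OF eta _ cnt, of l \<alpha> z] res by auto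
      then show ?thesis using k bit_le_1[of "z div \<eta>"] window_size_mu[of z] by linarith
    next
      case False
      then have "bit (z div \<eta>) + of_bool (z div \<eta> \<in> S) = 1"
        using t by (auto simp: bit_def extracted_def not_in_iff)
      then show ?thesis using window_size_mu[of z] k by linarith
    qed
  qed
  have step: "mult0 t + bit t + gap_size \<eta> \<nu> t + plain (Suc t) \<le> k - 1 \<longleftrightarrow>
      (mult0 t + bit t - 1) + gap_size \<eta> \<nu> t + (mult0 (Suc t) + bit (Suc t) - 1) \<le> k - 2"
    if W: "\<forall>z\<ge>\<eta>. window_size \<eta> \<nu> z + bit (z div \<eta>) \<le> k - 1" for t
  proof -
    have n: "mult0 (Suc t) = plain (Suc t) + of_bool (Suc t \<in> M)"
      using of_bool_le_count[of "Suc t"] by (simp add: mult0_def plain_def)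
    have 1: "window_size \<eta> \<nu> (Suc t * \<eta>) + bit (Suc t) \<le> k - 1"
      using W[rule_format, of "Suc t * \<eta>"] eta by simp
    have "(Suc t * \<eta> - 1) div \<eta> = t"
      using eta by (intro div_nat_eqI) (auto simp: mult.commute)
    then have 2: "gap_size \<eta> \<nu> t \<le> l"
      using window_size_le[OF eta _ cnt, of l \<alpha> "Suc t * \<eta> - 1"] res window_size_before_Suc[OF eta, of \<nu> t] by auto
    show ?thesis
    proof (rule parity_step)
      show "odd (mult0 t + bit t + gap_size \<eta> \<nu> t + plain (Suc t) + k - 1) = odd (bit (Suc t))"
        using odd_parity_sum_Suc[of t] k by (simp add: bit_def ac_simps)
      show "gap_size \<eta> \<nu> t + mult0 (Suc t) + bit (Suc t) \<le> k - 1"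
        using 1 window_size_Suc[OF eta, of \<nu> t] by (simp add: mult0_def)
    qed (use n 2 k bit_le_1 in auto)
  qed
  show ?thesis
    unfolding overlining_ok_iff bressoud_ok_iff using window_size step by auto
qed

end

section \<open>The bijection\<close>

definition size_multisets :: "nat \<Rightarrow> (nat \<Rightarrow> nat) \<Rightarrow> nat \<Rightarrow> nat \<Rightarrow> nat multiset set" where
  "size_multisets l \<alpha> \<eta> n = {\<nu>.
     (\<forall>x\<in>#\<nu>. 0 < x \<and> ([x = 0] (mod \<eta>) \<or> (\<exists>m\<in>{1..l}. [x = \<alpha> m] (mod \<eta>)))) \<and>
     (\<forall>x. \<not> \<eta> dvd x \<longrightarrow> count \<nu> x \<le> 1) \<and> \<Sum>\<^sub># \<nu> = n}"

lemma extracted_determines: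
  assumes "M \<subseteq> positions \<eta> \<nu>" "M' \<subseteq> positions \<eta> \<nu>"
    and eq: "extracted \<eta> k r \<nu> M = extracted \<eta> k r \<nu> M'"
  shows "t \<in> M \<longleftrightarrow> t \<in> M'"
proof (induction t rule: less_induct)
  case (less t)
  show ?case
  proof (cases "t \<in> positions \<eta> \<nu>")
    case True
    have "M \<inter> {..<t} = M' \<inter> {..<t}" using less by auto
    then have "overlined_below \<eta> \<nu> M t = overlined_below \<eta> \<nu> M' t" by (simp add: overlined_below_def)
    then have "parity_sum \<eta> k r \<nu> M t + of_bool (t \<in> M) = parity_sum \<eta> k r \<nu> M' t + of_bool (t \<in> M')"
      by (simp add: parity_sum_def)
    then have "even (parity_sum \<eta> k r \<nu> M t + of_bool (t \<in> M)) \<longleftrightarrow> even (parity_sum \<eta> k r \<nu> M' t + of_bool (t \<in> M'))"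
      by simp
    moreover have "even (parity_sum \<eta> k r \<nu> M t) \<longleftrightarrow> even (parity_sum \<eta> k r \<nu> M' t)"
      using eq True unfolding extracted_def positions_def by blast
    ultimately show ?thesis
      by (simp only: even_add) (cases "t \<in> M"; cases "t \<in> M'"; simp)
  qed (use assms in auto)
qed

text \<open>An injective map of a finite power set into itself is onto, so no overlining has to be
  built from a given S.\<close>

lemma bij_betw_extracted:
  assumes "0 < \<eta>"
  shows "bij_betw (extracted \<eta> k r \<nu>) (Pow (positions \<eta> \<nu>)) (Pow (positions \<eta> \<nu>))"
proof -
  have "inj_on (extracted \<eta> k r \<nu>) (Pow (positions \<eta> \<nu>))"
    by (intro inj_onI set_eqI) (rule extracted_determines[of _ \<eta> \<nu> _ k r], auto)
  moreover have "extracted \<eta> k r \<nu> ` Pow (positions \<eta> \<nu>) \<subseteq> Pow (positions \<eta> \<nu>)"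
    by (auto simp: extracted_def positions_def)
  ultimately show ?thesis
    using endo_inj_surj[of "Pow (positions \<eta> \<nu>)"] finite_positions[OF assms]
    by (simp add: bij_betw_def)
qed

definition marked_sizes where
  "marked_sizes l \<alpha> \<eta> k r n = {(\<nu>, M). \<nu> \<in> size_multisets l \<alpha> \<eta> n \<and> M \<subseteq> positions \<eta> \<nu> \<and> overlining_ok \<eta> k r \<nu> M}"

definition split_sizes where
  "split_sizes l \<alpha> \<eta> k r n = {(\<nu>, S). \<nu> \<in> size_multisets l \<alpha> \<eta> n \<and> S \<subseteq> positions \<eta> \<nu> \<and> bressoud_ok \<eta> k r (\<nu> - multiples \<eta> S)}"

lemma bij_betw_marked_split:
  assumes eta: "0 < \<eta>" and k: "l + 2 \<le> k" and r: "r \<le> k"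
  shows "bij_betw (\<lambda>(\<nu>, M). (\<nu>, extracted \<eta> k r \<nu> M)) (marked_sizes l \<alpha> \<eta> k r n)
     (split_sizes l \<alpha> \<eta> (k - 1) (min r (k - 1)) n)"
proof -
  have iff: "overlining_ok \<eta> k r \<nu> M \<longleftrightarrow> bressoud_ok \<eta> (k - 1) (min r (k - 1)) (\<nu> - multiples \<eta> (extracted \<eta> k r \<nu> M))"
    if "\<nu> \<in> size_multisets l \<alpha> \<eta> n" "M \<subseteq> positions \<eta> \<nu>" for \<nu> M
    using that by (intro overlining_ok_iff_bressoud_ok[OF eta k r]) (auto simp: size_multisets_def)
  show ?thesis
    unfolding bij_betw_def
  proof
    show "inj_on (\<lambda>(\<nu>, M). (\<nu>, extracted \<eta> k r \<nu> M)) (marked_sizes l \<alpha> \<eta> k r n)"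
      using bij_betw_extracted[OF eta, of k r]
      by (auto simp: inj_on_def bij_betw_def marked_sizes_def)
    show "(\<lambda>(\<nu>, M). (\<nu>, extracted \<eta> k r \<nu> M)) ` marked_sizes l \<alpha> \<eta> k r n = split_sizes l \<alpha> \<eta> (k - 1) (min r (k - 1)) n"
    proof (intro equalityI subsetI)
      fix p assume "p \<in> (\<lambda>(\<nu>, M). (\<nu>, extracted \<eta> k r \<nu> M)) ` marked_sizes l \<alpha> \<eta> k r n"
      then show "p \<in> split_sizes l \<alpha> \<eta> (k - 1) (min r (k - 1)) n"
        using iff by (auto simp: marked_sizes_def split_sizes_def extracted_def positions_def)
    next
      fix p assume "p \<in> split_sizes l \<alpha> \<eta> (k - 1) (min r (k - 1)) n"
      then obtain \<nu> S where p: "p = (\<nu>, S)" "\<nu> \<in> size_multisets l \<alpha> \<eta> n" "S \<subseteq> positions \<eta> \<nu>"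
        "bressoud_ok \<eta> (k - 1) (min r (k - 1)) (\<nu> - multiples \<eta> S)" by (auto simp: split_sizes_def)
      have "S \<in> extracted \<eta> k r \<nu> ` Pow (positions \<eta> \<nu>)"
        using bij_betw_extracted[OF eta, of k r \<nu>] p(3) by (simp add: bij_betw_def)
      then obtain M where M: "M \<subseteq> positions \<eta> \<nu>" "S = extracted \<eta> k r \<nu> M" by blast
      then have "(\<nu>, M) \<in> marked_sizes l \<alpha> \<eta> k r n"
        using iff[OF p(2) M(1)] p by (simp add: marked_sizes_def)
      then show "p \<in> (\<lambda>(\<nu>, M). (\<nu>, extracted \<eta> k r \<nu> M)) ` marked_sizes l \<alpha> \<eta> k r n"
        using p(1) M(2) by (force intro: image_eqI)
    qed
  qed
qed

section \<open>Decreasing lists as multisets with marks\<close>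

lemma distinct_iff_count_le: "distinct xs \<longleftrightarrow> (\<forall>x. count (mset xs) x \<le> 1)"
proof -
  have "count (mset xs) x \<le> 1 \<longleftrightarrow> count (mset xs) x = (if x \<in> set xs then 1 else 0)" for x
  proof (cases "x \<in> set xs")
    case True
    then have "1 \<le> count (mset xs) x" by (simp add: Suc_le_eq)
    then show ?thesis unfolding if_P[OF True] by presburger
  qed (simp add: count_mset_0_iff[THEN iffD2])
  then show ?thesis unfolding distinct_count_atmost_1 by simp
qed

lemma sorted_desc_unique:
  fixes xs ys :: "'a::linorder list"
  assumes "sorted_wrt (\<ge>) xs" "sorted_wrt (\<ge>) ys" "mset xs = mset ys"
  shows "xs = ys"
proof -
  have "sorted (rev xs)" "sorted (rev ys)" "mset (rev xs) = mset (rev ys)"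
    using assms by (simp_all add: sorted_wrt_rev)
  then have "rev xs = rev ys" by (metis properties_for_sort)
  then show ?thesis by simp
qed

lemma sorted_desc_list_of_multiset:
  "sorted_wrt (\<ge>) (rev (sorted_list_of_multiset M))" for M :: "'a::linorder multiset"
  using sorted_sorted_list_of_multiset[of M] by (simp add: sorted_wrt_rev)

text \<open>The conditions under which an overpartition is the same thing as a multiset of sizes
  with marks.\<close>

definition admissible where
  "admissible l \<alpha> \<eta> n xs \<longleftrightarrow> overpartition n xs \<and>
     (\<forall>x\<in>set xs. [psize x = 0] (mod \<eta>) \<or> (\<exists>m\<in>{1..l}. [psize x = \<alpha> m] (mod \<eta>))) \<and>
     (\<forall>x\<in>set xs. \<not> overlined x \<longrightarrow> \<eta> dvd psize x)"

lemma Bbar_set_iff: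
  assumes "0 < \<eta>" "2 \<le> k"
  shows "xs \<in> Bbar_set 0 l \<alpha> \<eta> k r n \<longleftrightarrow>
    admissible l \<alpha> \<eta> n xs \<and> overlining_ok \<eta> k r (mset (map psize xs)) (marked \<eta> xs)"
proof (cases "admissible l \<alpha> \<eta> n xs")
  case True
  then have *: "sorted_wrt (\<ge>) xs" "\<forall>x\<in>set xs. \<not> overlined x \<longrightarrow> \<eta> dvd psize x" "distinct (filter overlined xs)"
    by (auto simp: admissible_def overpartition_def)
  have m: "(2 - int 0) = 2" by simp
  have "1 \<le> k" using assms(2) by simp
  show ?thesis
    using True
    unfolding windows_iff_overlining_ok[OF assms(1) *(2,3) \<open>1 \<le> k\<close>, symmetric] Bbar_windows_iff[OF *(1) assms, symmetric]
      Bbar_set_def mem_Collect_eq admissible_def m by blast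
next
  case False
  then show ?thesis by (auto simp: Bbar_set_def admissible_def)
qed

lemma admissible_sizes:
  assumes eta: "0 < \<eta>" and xs: "admissible l \<alpha> \<eta> n xs"
  shows "mset (map psize xs) \<in> size_multisets l \<alpha> \<eta> n"
proof -
  have nonov: "\<forall>x\<in>set xs. \<not> overlined x \<longrightarrow> \<eta> dvd psize x" and dist: "distinct (filter overlined xs)"
    using xs by (auto simp: admissible_def overpartition_def)
  have "count (mset (map psize xs)) z \<le> 1" if "\<not> \<eta> dvd z" for z
  proof -
    have "count (mset (map psize xs)) z = length (filter (\<lambda>y. psize y = z) xs)"
      by (induction xs) auto
    also have "filter (\<lambda>y. psize y = z) xs = filter (\<lambda>y. y = Part z True) xs"
      using nonov that by (intro filter_cong) (auto simp: part_eq_iff)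
    also have "length \<dots> \<le> 1"
      using length_filter_overlined_eq[OF eta nonov dist, of z] by simp
    finally show ?thesis .
  qed
  then show ?thesis
    using xs by (auto simp: size_multisets_def admissible_def overpartition_def sum_mset_sum_list[symmetric] mset_map[symmetric] simp del: mset_map)
qed

text \<open>A decreasing list is fixed by the multiplicities of its parts. For an overlined part
  this is 0 or 1, decided by sizes and marks; a plain t\<eta> occurs as often as its size does, less
  the mark.\<close>

lemma admissible_unique:
  assumes eta: "0 < \<eta>" and xs: "admissible l \<alpha> \<eta> n xs" and ys: "admissible l \<alpha> \<eta> n ys"
    and eq: "mset (map psize xs) = mset (map psize ys)" "marked \<eta> xs = marked \<eta> ys"
  shows "xs = ys"
proof (rule sorted_desc_unique)
  show "mset xs = mset ys"
  proof (rule multiset_eqI)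
    fix x :: part
    have c: "count (mset zs) x = length (filter (\<lambda>y. y = x) zs)" for zs and x :: part
      by (induction zs) auto
    have zs: "\<forall>x\<in>set zs. \<not> overlined x \<longrightarrow> \<eta> dvd psize x" "distinct (filter overlined zs)"
      if "admissible l \<alpha> \<eta> n zs" for zs
      using that by (auto simp: admissible_def overpartition_def)
    obtain z b where x: "x = Part z b" by (cases x)
    show "count (mset xs) x = count (mset ys) x"
    proof (cases "b \<or> \<not> \<eta> dvd z")
      case True
      show ?thesis
      proof (cases b)
        case b: True
        have "Part z True \<in> set xs \<longleftrightarrow> Part z True \<in> set ys"
          by (simp only: overlined_mem_iff[OF eta zs[OF xs]] overlined_mem_iff[OF eta zs[OF ys]] eq)
        then show ?thesis
          unfolding c x using b length_filter_overlined_eq[OF eta zs[OF xs], of z]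
            length_filter_overlined_eq[OF eta zs[OF ys], of z] by simp
      next
        case False
        then have "x \<notin> set xs" "x \<notin> set ys" using True zs[OF xs] zs[OF ys] x by auto
        then show ?thesis by (metis count_mset_0_iff)
      qed
    next
      case False
      then obtain t where "z = t * \<eta>" "\<not> b" by (metis dvd_div_mult_self)
      then have "int (count (mset xs) x) = int (count (mset ys) x)"
        unfolding c x using length_nonoverlined[OF eta zs[OF xs], of t] length_nonoverlined[OF eta zs[OF ys], of t] eq
        by simp
      then show ?thesis by simp
    qed
  qed
qed (use xs ys in \<open>auto simp: admissible_def overpartition_def\<close>)

lemma multiples_eq:
  assumes "0 < \<eta>" "S \<subseteq> positions \<eta> \<nu>"
  shows "\<nu> - multiples \<eta> S + multiples \<eta> S = \<nu>" "finite S"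
proof -
  show fin: "finite S" using assms finite_positions finite_subset by blast
  have "multiples \<eta> S \<subseteq># \<nu>"
    by (rule multiples_subset[OF assms(1) _ fin]) (use assms in \<open>auto simp: positions_def\<close>)
  then show "\<nu> - multiples \<eta> S + multiples \<eta> S = \<nu>" by simp
qed

lemma admissible_exists:
  assumes eta: "0 < \<eta>" and nu: "\<nu> \<in> size_multisets l \<alpha> \<eta> n" and M: "M \<subseteq> positions \<eta> \<nu>"
  obtains xs where "admissible l \<alpha> \<eta> n xs" "mset (map psize xs) = \<nu>" "marked \<eta> xs = M"
proof -
  have finM: "finite M" and eq: "\<nu> - multiples \<eta> M + multiples \<eta> M = \<nu>"
    using multiples_eq[OF eta M] by auto
  \<comment> \<open>Once the marked copies are taken out, the rest is overlined only where (2)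
    forces it.\<close>
  define A where "A = image_mset (\<lambda>z. Part z (\<not> \<eta> dvd z)) (\<nu> - multiples \<eta> M)"
  define B where "B = image_mset (\<lambda>t. Part (t * \<eta>) True) (mset_set M)"
  define xs where "xs = rev (sorted_list_of_multiset (A + B))"
  have mset: "mset xs = A + B" by (simp add: xs_def)
  have size_multisets: "mset (map psize xs) = \<nu>"
    using eq by (simp add: mset A_def B_def multiples_def image_mset.compositionality comp_def)
  have set: "set xs = set_mset A \<union> set_mset B" by (metis mset set_mset_mset set_mset_union)
  have marked: "marked \<eta> xs = M"
    using finM eta unfolding marked_def set by (auto simp: A_def B_def)
  have nonov: "\<forall>x\<in>set xs. \<not> overlined x \<longrightarrow> \<eta> dvd psize x"
    unfolding set by (auto simp: A_def B_def)
  have "distinct (filter overlined xs)"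
  proof -
    have "count (A + B) (Part z True) \<le> 1" for z
    proof (cases "\<eta> dvd z")
      case True
      then have "Part z True \<notin># A" by (auto simp: A_def)
      moreover have "count B (Part z True) \<le> 1"
      proof -
        have "count B (Part z True) = card {t \<in> M. Part (t * \<eta>) True = Part z True}"
          unfolding B_def using finM by (simp add: size_filter_mset_eq[symmetric] filter_mset_image_mset)
        also have "\<dots> \<le> card {z div \<eta>}"
          using eta by (intro card_mono) auto
        finally show ?thesis by simp
      qed
      ultimately show ?thesis by (simp add: not_in_iff)
    next
      case False
      then have "Part z True \<notin># B" using finM by (auto simp: B_def)
      moreover have "count A (Part z True) \<le> 1"
      proof -
        have "count A (Part z True) = size {#y \<in># \<nu> - multiples \<eta> M. Part y (\<not> \<eta> dvd y) = Part z True#}"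
          unfolding A_def by (simp add: size_filter_mset_eq[symmetric] filter_mset_image_mset)
        also have "\<dots> \<le> size {#y \<in># \<nu> - multiples \<eta> M. y = z#}"
          by (rule size_filter_mset_mono) auto
        also have "\<dots> = count (\<nu> - multiples \<eta> M) z" by (rule size_filter_mset_eq)
        also have "\<dots> \<le> count \<nu> z" by simp
        also have "\<dots> \<le> 1" using nu False by (auto simp: size_multisets_def)
        finally show ?thesis .
      qed
      ultimately show ?thesis by (simp add: not_in_iff)
    qed
    then have le: "count (mset xs) x \<le> 1" if "overlined x" for x
      unfolding mset using that by (metis part.collapse)
    show ?thesis
      unfolding distinct_iff_count_le using le by simp
  qed
  moreover have "psize x \<in># \<nu>" if "x \<in> set xs" for x
    using that by (auto simp flip: size_multisets)
  moreover have "(\<Sum>x\<leftarrow>xs. psize x) = n"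
    using nu unfolding sum_mset_sum_list[symmetric] size_multisets by (simp add: size_multisets_def)
  moreover have "sorted_wrt (\<ge>) xs"
    unfolding xs_def by (rule sorted_desc_list_of_multiset)
  ultimately have "admissible l \<alpha> \<eta> n xs"
    using nonov nu by (auto simp: admissible_def overpartition_def size_multisets_def)
  then show ?thesis using that size_multisets marked by blast
qed

lemma bij_betw_Bbar_marked:
  assumes eta: "0 < \<eta>" and "2 \<le> k"
  shows "bij_betw (\<lambda>xs. (mset (map psize xs), marked \<eta> xs)) (Bbar_set 0 l \<alpha> \<eta> k r n) (marked_sizes l \<alpha> \<eta> k r n)"
  unfolding bij_betw_def
proof
  show "inj_on (\<lambda>xs. (mset (map psize xs), marked \<eta> xs)) (Bbar_set 0 l \<alpha> \<eta> k r n)"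
    using admissible_unique[OF eta] by (intro inj_onI) (auto simp: Bbar_set_iff[OF assms])
  show "(\<lambda>xs. (mset (map psize xs), marked \<eta> xs)) ` Bbar_set 0 l \<alpha> \<eta> k r n = marked_sizes l \<alpha> \<eta> k r n"
  proof (intro equalityI subsetI)
    fix p assume "p \<in> (\<lambda>xs. (mset (map psize xs), marked \<eta> xs)) ` Bbar_set 0 l \<alpha> \<eta> k r n"
    then obtain xs where p: "p = (mset (map psize xs), marked \<eta> xs)" "xs \<in> Bbar_set 0 l \<alpha> \<eta> k r n"
      by blast
    have "marked \<eta> xs \<subseteq> positions \<eta> (mset (map psize xs))"
      by (force simp: marked_def positions_def)
    then show "p \<in> marked_sizes l \<alpha> \<eta> k r n"
      using p admissible_sizes[OF eta] unfolding marked_sizes_def Bbar_set_iff[OF assms] by blast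
  next
    fix p assume "p \<in> marked_sizes l \<alpha> \<eta> k r n"
    then obtain \<nu> M where p: "p = (\<nu>, M)" "\<nu> \<in> size_multisets l \<alpha> \<eta> n" "M \<subseteq> positions \<eta> \<nu>" "overlining_ok \<eta> k r \<nu> M"
      by (auto simp: marked_sizes_def)
    obtain xs where "admissible l \<alpha> \<eta> n xs" "mset (map psize xs) = \<nu>" "marked \<eta> xs = M"
      using admissible_exists[OF eta p(2,3)] .
    then show "p \<in> (\<lambda>xs. (mset (map psize xs), marked \<eta> xs)) ` Bbar_set 0 l \<alpha> \<eta> k r n"
      using p by (intro image_eqI[of _ _ xs]) (simp_all add: Bbar_set_iff[OF assms] del: mset_map)
  qed
qed

text \<open>The same passage to windows as for overpartitions, with the sizes not divisible by
  \<eta> in the role of overlined parts. For j = 1 the congruence in (5) is modulo 1.\<close>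

lemma Bress_set_iff:
  assumes eta: "0 < \<eta>" and k: "1 \<le> k"
  shows "xs \<in> Bress_set 1 l \<alpha> \<eta> k r n \<longleftrightarrow>
     sorted_wrt (\<ge>) xs \<and> mset xs \<in> size_multisets l \<alpha> \<eta> n \<and> bressoud_ok \<eta> k r (mset xs)"
proof -
  define C where "C x y \<longleftrightarrow> x < y + \<eta> \<or> \<eta> dvd x \<and> x \<le> y + \<eta>" for x y
  have len: "length (filter Q xs) = size (filter_mset Q (mset xs))" for Q
    by (metis mset_filter size_mset)
  have dist: "distinct (filter (\<lambda>x. \<not> \<eta> dvd x) xs) \<longleftrightarrow> (\<forall>x. \<not> \<eta> dvd x \<longrightarrow> count (mset xs) x \<le> 1)"
  proof -
    have "distinct (filter (\<lambda>x. \<not> \<eta> dvd x) xs) \<longleftrightarrow> (\<forall>x. count (mset (filter (\<lambda>x. \<not> \<eta> dvd x) xs)) x \<le> 1)"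
      by (rule distinct_iff_count_le)
    then show ?thesis by auto
  qed
  have windows: "(\<forall>i. i + k \<le> length xs \<longrightarrow> xs ! i \<ge> xs ! (i + k - 1) + \<eta> \<and>
        (\<eta> dvd xs ! i \<longrightarrow> xs ! i > xs ! (i + k - 1) + \<eta>)) \<longleftrightarrow>
     (\<forall>z\<in>#mset xs. \<not> \<eta> dvd z \<longrightarrow> window_size \<eta> (mset xs) z \<le> k - 1) \<and>
     (\<forall>t. t * \<eta> \<in># mset xs \<longrightarrow> closed_window_size \<eta> (mset xs) t \<le> k - 1)" if sorted: "sorted_wrt (\<ge>) xs"
  proof -
    have "(\<forall>i. i + k \<le> length xs \<longrightarrow> xs ! i \<ge> xs ! (i + k - 1) + \<eta> \<and>
        (\<eta> dvd xs ! i \<longrightarrow> xs ! i > xs ! (i + k - 1) + \<eta>)) \<longleftrightarrow>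
        (\<forall>i. i + k \<le> length xs \<longrightarrow> \<not> C (xs ! i) (xs ! (i + k - 1)))"
      unfolding C_def by (auto simp: not_less not_le)
    also have "\<dots> \<longleftrightarrow> (\<forall>x\<in>set xs. length (window C xs x) < k)"
      by (rule windows_bounded_iff[OF sorted _ _ k]) (use eta in \<open>auto simp: C_def\<close>)
    also have "\<dots> \<longleftrightarrow> (\<forall>x\<in>set xs. length (window C xs x) \<le> k - 1)"
      using k by (auto simp: less_eq_Suc_le[symmetric] less_Suc_eq_le[symmetric])
    also have "\<dots> \<longleftrightarrow> (\<forall>z\<in>#mset xs. \<not> \<eta> dvd z \<longrightarrow> length (window C xs z) \<le> k - 1) \<and>
       (\<forall>t. t * \<eta> \<in># mset xs \<longrightarrow> length (window C xs (t * \<eta>)) \<le> k - 1)"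
      by (metis dvd_div_mult_self set_mset_mset)
    also have "(\<forall>z\<in>#mset xs. \<not> \<eta> dvd z \<longrightarrow> length (window C xs z) \<le> k - 1) \<longleftrightarrow>
       (\<forall>z\<in>#mset xs. \<not> \<eta> dvd z \<longrightarrow> window_size \<eta> (mset xs) z \<le> k - 1)"
      unfolding window_def len window_size_def C_def by (simp add: conj_commute cong: conj_cong)
    also have "(\<forall>t. t * \<eta> \<in># mset xs \<longrightarrow> length (window C xs (t * \<eta>)) \<le> k - 1) \<longleftrightarrow>
       (\<forall>t. t * \<eta> \<in># mset xs \<longrightarrow> closed_window_size \<eta> (mset xs) t \<le> k - 1)"
    proof -
      have "(y \<le> t * \<eta> \<and> C (t * \<eta>) y) \<longleftrightarrow> (t * \<eta> \<le> y + \<eta> \<and> y \<le> t * \<eta>)" for y t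
        by (auto simp: C_def)
      then show ?thesis unfolding window_def len closed_window_size_def by simp
    qed
    finally show ?thesis .
  qed
  show ?thesis
    using windows
    unfolding Bress_set_def mem_Collect_eq is_partition_def size_multisets_def bressoud_ok_def dist len
    by (auto simp: sum_mset_sum_list)
qed

section \<open>Convolution of distinct multiples with Bressoud's partitions\<close>

definition pairs where
  "pairs l \<alpha> \<eta> k r n = {(S, xs). finite S \<and> 0 \<notin> S \<and> \<eta> * \<Sum>S \<le> n \<and> xs \<in> Bress_set 1 l \<alpha> \<eta> k r (n - \<eta> * \<Sum>S)}"

lemma size_multisets_add_multiples:
  assumes "0 < \<eta>" "finite S" "0 \<notin> S"
  shows "\<mu> + multiples \<eta> S \<in> size_multisets l \<alpha> \<eta> n \<longleftrightarrow> \<eta> * \<Sum>S \<le> n \<and> \<mu> \<in> size_multisets l \<alpha> \<eta> (n - \<eta> * \<Sum>S)"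
proof -
  have "\<Sum>\<^sub># (multiples \<eta> S) = \<eta> * \<Sum>S"
    by (simp add: multiples_def sum_unfold_sum_mset[symmetric] sum_distrib_left mult.commute)
  moreover have "count (multiples \<eta> S) x = 0" if "\<not> \<eta> dvd x" for x
    using that assms by (auto simp: multiples_def not_in_iff[symmetric])
  moreover have "0 < x \<and> [x = 0] (mod \<eta>)" if "x \<in># multiples \<eta> S" for x
    using that assms by (auto simp: multiples_def cong_0_iff intro: gr0I)
  ultimately show ?thesis
    unfolding size_multisets_def by auto
qed

text \<open>The sum of the two multisets alone forgets S; keeping S as second component makes the
  map injective, and subtraction inverts it.\<close>

lemma bij_betw_pairs_split:
  assumes eta: "0 < \<eta>" and k: "1 \<le> k"
  shows "bij_betw (\<lambda>(S, xs). (mset xs + multiples \<eta> S, S)) (pairs l \<alpha> \<eta> k r n) (split_sizes l \<alpha> \<eta> k r n)"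
  unfolding bij_betw_def
proof
  show "inj_on (\<lambda>(S, xs). (mset xs + multiples \<eta> S, S)) (pairs l \<alpha> \<eta> k r n)"
    by (auto simp: inj_on_def pairs_def Bress_set_iff[OF assms] simp del: One_nat_def intro: sorted_desc_unique)
  show "(\<lambda>(S, xs). (mset xs + multiples \<eta> S, S)) ` pairs l \<alpha> \<eta> k r n = split_sizes l \<alpha> \<eta> k r n"
  proof (intro equalityI subsetI)
    fix p assume "p \<in> (\<lambda>(S, xs). (mset xs + multiples \<eta> S, S)) ` pairs l \<alpha> \<eta> k r n"
    then obtain S xs where p: "p = (mset xs + multiples \<eta> S, S)" "finite S" "0 \<notin> S" "\<eta> * \<Sum>S \<le> n"
      "mset xs \<in> size_multisets l \<alpha> \<eta> (n - \<eta> * \<Sum>S)" "bressoud_ok \<eta> k r (mset xs)"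
      by (auto simp: pairs_def Bress_set_iff[OF assms] simp del: One_nat_def)
    have "S \<subseteq> positions \<eta> (mset xs + multiples \<eta> S)"
      using p(2) by (auto simp: positions_def multiples_def)
    then show "p \<in> split_sizes l \<alpha> \<eta> k r n"
      using p size_multisets_add_multiples[OF eta p(2,3)] by (simp add: split_sizes_def)
  next
    fix p assume "p \<in> split_sizes l \<alpha> \<eta> k r n"
    then obtain \<nu> S where p: "p = (\<nu>, S)" "\<nu> \<in> size_multisets l \<alpha> \<eta> n" "S \<subseteq> positions \<eta> \<nu>"
      "bressoud_ok \<eta> k r (\<nu> - multiples \<eta> S)" by (auto simp: split_sizes_def)
    define \<mu> where "\<mu> = \<nu> - multiples \<eta> S"
    define xs where "xs = rev (sorted_list_of_multiset \<mu>)"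
    have nu: "\<nu> = \<mu> + multiples \<eta> S"
      unfolding \<mu>_def by (rule multiples_eq(1)[OF eta p(3), symmetric])
    have fin: "finite S" by (rule multiples_eq(2)[OF eta p(3)])
    have "0 \<notin> S"
    proof
      assume "0 \<in> S"
      then have "0 \<in># \<nu>" using p(3) by (auto simp: positions_def)
      then show False using p(2) by (auto simp: size_multisets_def)
    qed
    have mset: "mset xs = \<mu>" by (simp add: xs_def)
    have "\<eta> * \<Sum>S \<le> n" "mset xs \<in> size_multisets l \<alpha> \<eta> (n - \<eta> * \<Sum>S)"
      using p(2) size_multisets_add_multiples[OF eta fin \<open>0 \<notin> S\<close>, of \<mu> l \<alpha> n] unfolding nu mset by blast+
    moreover have "sorted_wrt (\<ge>) xs" unfolding xs_def by (rule sorted_desc_list_of_multiset)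
    moreover have "bressoud_ok \<eta> k r (mset xs)" using p(4) unfolding mset \<mu>_def .
    ultimately have "(S, xs) \<in> pairs l \<alpha> \<eta> k r n"
      unfolding pairs_def using fin \<open>0 \<notin> S\<close> Bress_set_iff[OF assms] by blast
    then show "p \<in> (\<lambda>(S, xs). (mset xs + multiples \<eta> S, S)) ` pairs l \<alpha> \<eta> k r n"
      using p(1) nu mset by (force intro: image_eqI)
  qed
qed

text \<open>Grouping the pairs by the weight \<open>i\<close> of S gives a coefficient of a Cauchy
  product.\<close>

lemma card_pairs:
  assumes eta: "0 < \<eta>"
  shows "card (pairs l \<alpha> \<eta> k r n) = (\<Sum>i=0..n. card {S. finite S \<and> 0 \<notin> S \<and> \<eta> * \<Sum>S = i} * Bress 1 l \<alpha> \<eta> k r (n - i))"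
proof -
  define D where "D i = {S. finite S \<and> 0 \<notin> S \<and> \<eta> * \<Sum>S = i}" for i
  have fin: "finite (D i)" for i
  proof (rule finite_subset)
    show "D i \<subseteq> Pow {..i}"
    proof (intro subsetI PowI)
      fix S t assume S: "S \<in> D i" and t: "t \<in> S"
      then have "t \<le> \<Sum>S" using member_le_sum[of t S "\<lambda>x. x"] by (simp add: D_def)
      also have "\<dots> \<le> \<eta> * \<Sum>S" using eta by simp
      finally show "t \<in> {..i}" using S by (simp add: D_def)
    qed
  qed simp
  have "pairs l \<alpha> \<eta> k r n = (\<Union>i\<in>{0..n}. D i \<times> Bress_set 1 l \<alpha> \<eta> k r (n - i))"
    by (auto simp: pairs_def D_def)
  also have "card \<dots> = (\<Sum>i=0..n. card (D i \<times> Bress_set 1 l \<alpha> \<eta> k r (n - i)))"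
    by (rule card_UN_disjoint) (auto simp: fin finite_Bress_set, auto simp: D_def)
  finally show ?thesis by (simp add: card_cartesian_product Bress_def D_def)
qed

lemma Bbar_generating_function:
  assumes eta: "0 < \<eta>" and k: "l + 2 \<le> k" and r: "r \<le> k"
  shows "Abs_fps (\<lambda>n. int (Bbar 0 l \<alpha> \<eta> k r n)) =
    qpoch_inf (- (fps_X ^ \<eta>)) (fps_X ^ \<eta>) * Abs_fps (\<lambda>n. int (Bress 1 l \<alpha> \<eta> (k - 1) (min r (k - 1)) n))"
proof (rule fps_ext)
  fix n
  have "Bbar 0 l \<alpha> \<eta> k r n = card (marked_sizes l \<alpha> \<eta> k r n)"
    unfolding Bbar_def using k by (intro bij_betw_same_card[OF bij_betw_Bbar_marked[OF eta]]) simp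
  also have "\<dots> = card (split_sizes l \<alpha> \<eta> (k - 1) (min r (k - 1)) n)"
    by (rule bij_betw_same_card[OF bij_betw_marked_split[OF assms]])
  also have "\<dots> = card (pairs l \<alpha> \<eta> (k - 1) (min r (k - 1)) n)"
    using k by (intro bij_betw_same_card[OF bij_betw_pairs_split[OF eta], symmetric]) simp
  finally show "fps_nth (Abs_fps (\<lambda>n. int (Bbar 0 l \<alpha> \<eta> k r n))) n =
    fps_nth (qpoch_inf (- (fps_X ^ \<eta>)) (fps_X ^ \<eta>) * Abs_fps (\<lambda>n. int (Bress 1 l \<alpha> \<eta> (k - 1) (min r (k - 1)) n))) n"
    by (simp add: fps_mult_nth qpoch_nth[OF eta] card_pairs[OF eta])
qed

theorem theorem1p14:
  fixes l \<eta> :: nat and \<alpha> :: "nat \<Rightarrow> nat"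
  assumes "0 < \<eta>"
    and "\<forall>i\<in>{1..l}. 0 < \<alpha> i \<and> \<alpha> i < \<eta>"
    and "\<forall>i\<in>{1..l}. \<forall>i'\<in>{1..l}. i < i' \<longrightarrow> \<alpha> i < \<alpha> i'"
    and "\<forall>i\<in>{1..l}. \<alpha> i = \<eta> - \<alpha> (l + 1 - i)"
  shows "(\<forall>k r :: nat. k > r \<and> r \<ge> l \<and> k - 1 > l \<longrightarrow>
            Abs_fps (\<lambda>n. int (Bbar 0 l \<alpha> \<eta> k r n)) =
            qpoch_inf (- (fps_X ^ \<eta>)) (fps_X ^ \<eta>) * Abs_fps (\<lambda>n. int (Bress 1 l \<alpha> \<eta> (k - 1) r n))) \<and>
         (\<forall>k :: nat. k - 1 > l \<longrightarrow>
            Abs_fps (\<lambda>n. int (Bbar 0 l \<alpha> \<eta> k k n)) =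
            qpoch_inf (- (fps_X ^ \<eta>)) (fps_X ^ \<eta>) * Abs_fps (\<lambda>n. int (Bress 1 l \<alpha> \<eta> (k - 1) (k - 1) n)))"
proof (intro conjI allI impI)
  fix k r :: nat assume "k > r \<and> r \<ge> l \<and> k - 1 > l"
  then have "l + 2 \<le> k" "r \<le> k" "min r (k - 1) = r" by auto
  then show "Abs_fps (\<lambda>n. int (Bbar 0 l \<alpha> \<eta> k r n)) =
      qpoch_inf (- (fps_X ^ \<eta>)) (fps_X ^ \<eta>) * Abs_fps (\<lambda>n. int (Bress 1 l \<alpha> \<eta> (k - 1) r n))"
    using Bbar_generating_function[OF assms(1), of l k r] by simp
next
  fix k :: nat assume "k - 1 > l"
  then have "l + 2 \<le> k" "min k (k - 1) = k - 1" by auto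
  then show "Abs_fps (\<lambda>n. int (Bbar 0 l \<alpha> \<eta> k k n)) =
      qpoch_inf (- (fps_X ^ \<eta>)) (fps_X ^ \<eta>) * Abs_fps (\<lambda>n. int (Bress 1 l \<alpha> \<eta> (k - 1) (k - 1) n))"
    using Bbar_generating_function[OF assms(1), of l k k] by simp
qed

end
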